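(* Let $l\geq 5$ be an integer and let $x_1,x_2,x_3,x_4$ be indeterminates (parameters). Then \[ \sum_{\substack{l_1\geq 2,\ l_2,l_3,l_4\geq 1\\ l_1+l_2+l_3+l_4=l}} P_{l_1,l_2,l_3,l_4}(x_1,x_2,x_3,x_4)\,\zeta(l_1,l_2,l_3,l_4) =\Bigg(\sum_{\substack{l_1,l_2,l_3,l_4\geq 1\\ l_1+l_2+l_3+l_4=l}} x_1^{l_1-1}x_2^{l_2-1}x_3^{l_3-1}x_4^{l_4-1}\Bigg)\zeta(l), \] where \begin{align*} P_{l_1,l_2,l_3,l_4}={}&\sum_{\sigma\in S_4}\sigma\cdot\Big(x_{1234}^{l_1-1}x_{234}^{l_2-1}x_{34}^{l_3-1}x_4^{l_4-1}\Big)\\ &-\sum_{\sigma\in C_4\cup C_4(34)}\sigma\cdot\Big(\sum_{\rho\in\langle(234)\rangle}x_{134}^{l_1-1}x_{\rho(2)\rho(3)\rho(4)}^{l_2-1}x_{\rho(3)\rho(4)}^{l_3-1}x_{\rho(4)}^{l_4-1} +\sum_{\rho\in\langle(24)\rangle}x_{314}^{l_1-1}x_{14}^{l_2-1}x_{\rho(2)\rho(4)}^{l_3-1}x_{\rho(4)}^{l_4-1} +x_{341}^{l_1-1}x_{41}^{l_2-1}x_1^{l_3-1}x_2^{l_4-1}\Big)\\ &+\sum_{\sigma\in C_4}\sigma\cdot\Big(\sum_{\nu\in B}\ \sum_{\rho\in\langle(\nu(2)\,4)\rangle}x_{1\nu(3)}^{l_1-1}x_{\nu(3)2}^{l_2-1}x_{\rho\nu(2)\rho(4)}^{l_3-1}x_{\rho(4)}^{l_4-1}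 +\sum_{\nu\in B}x_{\nu(1)3}^{l_1-1}x_{2\nu(3)}^{l_2-1}x_{\nu(3)}^{l_3-1}x_{\nu(4)}^{l_4-1}\\ &\qquad\qquad+x_{41}^{l_1-1}x_1^{l_2-1}x_2^{l_3-1}x_3^{l_4-1}-x_1^{l_1-1}x_2^{l_2-1}x_3^{l_3-1}x_4^{l_4-1}\Big). \end{align*}
   Context: For positive integers $l_1,\dots,l_n$ with $l_1\geq 2$, the multiple zeta value is $\zeta(l_1,\dots,l_n)=\sum_{m_1>m_2>\cdots>m_n>0}m_1^{-l_1}\cdots m_n^{-l_n}$; $\zeta(l)$ is the Riemann zeta value. $S_4$ is the symmetric group on $\{1,2,3,4\}$, $e$ its identity, products are compositions ($\sigma\rho(i)=\sigma(\rho(i))$), and $(i_1\,i_2\dots i_m)$ denotes the cyclic permutation $i_1\mapsto i_2\mapsto\cdots\mapsto i_m\mapsto i_1$. $\langle\sigma_1,\dots,\sigma_m\rangle$ is the subgroup generated by $\sigma_1,\dots,\sigma_m$. $C_4=\langle(1234)\rangle$ (cyclic of order 4), $B=\{e,(1234)\}\subset C_4$, and for $H\subset S_4$, $\alpha\in S_4$, $H\alpha=\{h\alpha:h\in H\}$ (so $C_4(34)$ is a right coset). For integers $1\le j_a\le 4$ and $k\ge 0$, $x_{j_1\cdots j_m}^k:=(x_{j_1}+\cdots+x_{j_m})^k$. $S_4$ acts on $\mathbb{C}[x_1,x_2,x_3,x_4]$ by $\sigma\cdot f(x_1,x_2,x_3,x_4)=f(x_{\sigma(1)},x_{\sigma(2)},x_{\sigma(3)},x_{\sigma(4)})$;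 thus e.g. $\sigma\cdot x_{\rho(2)\rho(4)}^k=x_{\sigma\rho(2)\sigma\rho(4)}^k$. *)

theory Defs
  imports
    "HOL-Analysis.Infinite_Sum"
    "HOL-Algebra.Sym_Groups"
    "HOL-Algebra.Generated_Groups"
    "HOL-Library.Poly_Mapping"
begin

definition mzv :: "nat list \<Rightarrow> real" where
  "mzv ls = (\<Sum>\<^sub>\<infinity>ms\<in>{ms. length ms = length ls \<and> sorted_wrt (>) ms \<and> (\<forall>m\<in>set ms. 0 < m)}.
     \<Prod>i<length ls. 1 / real (ms ! i) ^ (ls ! i))"

definition zeta_nat :: "nat \<Rightarrow> real" where
  "zeta_nat s = suminf (\<lambda>m. 1 / real (Suc m) ^ s)"

text \<open>
  Polynomials with complex coefficients in indeterminates indexed by \<^typ>\<open>nat\<close>, as finitely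
  supported maps from monomials (exponent vectors) to coefficients. The ring of
  polynomials in the four indeterminates numbered 1, 2, 3, 4 is a subring; indices
  start at 1, as in \<^const>\<open>sym_group\<close>.
\<close>

type_synonym cpoly = "(nat \<Rightarrow>\<^sub>0 nat) \<Rightarrow>\<^sub>0 complex"

definition indet :: "nat \<Rightarrow> cpoly" where
  "indet i = Poly_Mapping.single (Poly_Mapping.single i 1) 1"

definition scalar :: "complex \<Rightarrow> cpoly" where
  "scalar c = Poly_Mapping.single 0 c"

text \<open>The action by renaming indeterminates, i.e. substituting \<open>indet (\<sigma> i)\<close> for every \<open>indet i\<close>.\<close>

definition act :: "(nat \<Rightarrow> nat) \<Rightarrow> cpoly \<Rightarrow> cpoly" (infixr "\<bullet>\<^sub>S" 75) where
  "\<sigma> \<bullet>\<^sub>S f = (\<Sum>m\<in>Poly_Mapping.keys f. scalar (Poly_Mapping.lookup f m) *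
     (\<Prod>i\<in>Poly_Mapping.keys m. indet (\<sigma> i) ^ Poly_Mapping.lookup m i))"

text \<open>\<open>xpow [j\<^sub>1, \<dots>, j\<^sub>m] k\<close> is \<open>(x\<^bsub>j\<^sub>1\<^esub> + \<dots> + x\<^bsub>j\<^sub>m\<^esub>)\<^sup>k\<close>.\<close>

definition xpow :: "nat list \<Rightarrow> nat \<Rightarrow> cpoly" where
  "xpow js k = (\<Sum>j\<leftarrow>js. indet j) ^ k"

lemma act_superset:
  assumes "finite M" "Poly_Mapping.keys f \<subseteq> M"
  shows "\<sigma> \<bullet>\<^sub>S f = (\<Sum>m\<in>M. scalar (Poly_Mapping.lookup f m) *
     (\<Prod>i\<in>Poly_Mapping.keys m. indet (\<sigma> i) ^ Poly_Mapping.lookup m i))"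
  unfolding act_def
  by (rule sum.mono_neutral_left) (use assms in \<open>auto simp: in_keys_iff scalar_def\<close>)

lemma act_0 [simp]: "\<sigma> \<bullet>\<^sub>S 0 = 0"
  by (simp add: act_def)

lemma act_add: "\<sigma> \<bullet>\<^sub>S (f + g) = \<sigma> \<bullet>\<^sub>S f + \<sigma> \<bullet>\<^sub>S g"
proof -
  let ?M = "Poly_Mapping.keys f \<union> Poly_Mapping.keys g"
  have "Poly_Mapping.keys (f + g) \<subseteq> ?M"
    by (rule Poly_Mapping.keys_add)
  then show ?thesis
    by (simp add: act_superset[of ?M] lookup_add scalar_def single_add algebra_simps
        flip: sum.distrib)
qed

lemma act_single:
  "\<sigma> \<bullet>\<^sub>S Poly_Mapping.single m c =
     scalar c * (\<Prod>i\<in>Poly_Mapping.keys m. indet (\<sigma> i) ^ Poly_Mapping.lookup m i)"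
  by (subst act_superset[of "{m}"]) auto

lemma prod_indet_add:
  "(\<Prod>i\<in>Poly_Mapping.keys (m + n). indet (\<sigma> i) ^ Poly_Mapping.lookup (m + n) i) =
   (\<Prod>i\<in>Poly_Mapping.keys m. indet (\<sigma> i) ^ Poly_Mapping.lookup m i) *
   (\<Prod>i\<in>Poly_Mapping.keys n. indet (\<sigma> i) ^ Poly_Mapping.lookup n i)"
proof -
  let ?K = "Poly_Mapping.keys m \<union> Poly_Mapping.keys n"
  have K: "(\<Prod>i\<in>Poly_Mapping.keys p. indet (\<sigma> i) ^ Poly_Mapping.lookup p i) =
      (\<Prod>i\<in>?K. indet (\<sigma> i) ^ Poly_Mapping.lookup p i)" if "Poly_Mapping.keys p \<subseteq> ?K" for p
    by (rule prod.mono_neutral_left) (use that in \<open>auto simp: in_keys_iff\<close>)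
  have "Poly_Mapping.keys (m + n) \<subseteq> ?K"
    by (rule Poly_Mapping.keys_add)
  show ?thesis
    unfolding K[OF \<open>Poly_Mapping.keys (m + n) \<subseteq> ?K\<close>] K[OF Un_upper1] K[OF Un_upper2]
    by (simp add: lookup_add power_add prod.distrib)
qed

lemma cpoly_induct [case_names zero add]:
  fixes f :: cpoly
  assumes "Q 0" "\<And>m c f. Q f \<Longrightarrow> Q (Poly_Mapping.single m c + f)"
  shows "Q f"
proof -
  have "Q (\<Sum>m\<in>M. Poly_Mapping.single m (Poly_Mapping.lookup f m))" if "finite M" for M
    using that by induction (auto simp: assms)
  moreover have "f = (\<Sum>m\<in>Poly_Mapping.keys f. Poly_Mapping.single m (Poly_Mapping.lookup f m))"
    by (rule poly_mapping_eqI) (auto simp: lookup_sum lookup_single when_def in_keys_iff)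
  ultimately show ?thesis
    using finite_keys by metis
qed

lemma act_mult: "\<sigma> \<bullet>\<^sub>S (f * g) = \<sigma> \<bullet>\<^sub>S f * \<sigma> \<bullet>\<^sub>S g"
proof -
  have 1: "\<sigma> \<bullet>\<^sub>S (Poly_Mapping.single m c * g) = \<sigma> \<bullet>\<^sub>S Poly_Mapping.single m c * \<sigma> \<bullet>\<^sub>S g" for m c
  proof (induction g rule: cpoly_induct)
    case (add n d g)
    have "scalar (c * d) = scalar c * scalar d"
      by (simp add: scalar_def mult_single)
    then have "\<sigma> \<bullet>\<^sub>S (Poly_Mapping.single m c * Poly_Mapping.single n d) =
        \<sigma> \<bullet>\<^sub>S Poly_Mapping.single m c * \<sigma> \<bullet>\<^sub>S Poly_Mapping.single n d"
      by (simp add: mult_single act_single prod_indet_add mult_ac)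
    with add show ?case
      by (simp add: distrib_left act_add)
  qed simp
  show ?thesis
    by (induction f rule: cpoly_induct) (simp_all add: distrib_right act_add 1)
qed

lemma act_indet [simp]: "\<sigma> \<bullet>\<^sub>S indet i = indet (\<sigma> i)"
  unfolding indet_def[of i] by (simp add: act_single scalar_def)

lemma act_1 [simp]: "\<sigma> \<bullet>\<^sub>S 1 = 1"
  using act_single[of \<sigma> 0 1] by (simp add: scalar_def)

lemma act_xpow: "\<sigma> \<bullet>\<^sub>S xpow js k = xpow (map \<sigma> js) k"
proof -
  have "\<sigma> \<bullet>\<^sub>S (\<Sum>j\<leftarrow>js. indet j) = (\<Sum>j\<leftarrow>map \<sigma> js. indet j)"
    by (induction js) (simp_all add: act_add)
  then show ?thesis
    unfolding xpow_def by (induction k) (simp_all add: act_mult)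
qed

definition S4 :: "(nat \<Rightarrow> nat) set" where
  "S4 = carrier (sym_group 4)"

definition gen4 :: "(nat \<Rightarrow> nat) \<Rightarrow> (nat \<Rightarrow> nat) set" where
  "gen4 \<sigma> = generate (sym_group 4) {\<sigma>}"

definition C4 :: "(nat \<Rightarrow> nat) set" where
  "C4 = gen4 (cycle_of_list [1, 2, 3, 4])"

definition B4 :: "(nat \<Rightarrow> nat) set" where
  "B4 = {id, cycle_of_list [1, 2, 3, 4]}"

definition wpoly :: "nat \<Rightarrow> nat \<Rightarrow> nat \<Rightarrow> nat \<Rightarrow> cpoly" where
  "wpoly l1 l2 l3 l4 =
     (\<Sum>\<sigma>\<in>S4. \<sigma> \<bullet>\<^sub>S
        (xpow [1,2,3,4] (l1-1) * xpow [2,3,4] (l2-1) * xpow [3,4] (l3-1) * xpow [4] (l4-1)))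
   - (\<Sum>\<sigma>\<in>C4 \<union> (C4 #>\<^bsub>sym_group 4\<^esub> cycle_of_list [3, 4]). \<sigma> \<bullet>\<^sub>S
        ((\<Sum>\<rho>\<in>gen4 (cycle_of_list [2, 3, 4]).
            xpow [1,3,4] (l1-1) * xpow [\<rho> 2, \<rho> 3, \<rho> 4] (l2-1)
              * xpow [\<rho> 3, \<rho> 4] (l3-1) * xpow [\<rho> 4] (l4-1))
         + (\<Sum>\<rho>\<in>gen4 (cycle_of_list [2, 4]).
            xpow [3,1,4] (l1-1) * xpow [1,4] (l2-1)
              * xpow [\<rho> 2, \<rho> 4] (l3-1) * xpow [\<rho> 4] (l4-1))
         + xpow [3,4,1] (l1-1) * xpow [4,1] (l2-1) * xpow [1] (l3-1) * xpow [2] (l4-1)))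
   + (\<Sum>\<sigma>\<in>C4. \<sigma> \<bullet>\<^sub>S
        ((\<Sum>\<nu>\<in>B4. \<Sum>\<rho>\<in>gen4 (cycle_of_list [\<nu> 2, 4]).
            xpow [1, \<nu> 3] (l1-1) * xpow [\<nu> 3, 2] (l2-1)
              * xpow [\<rho> (\<nu> 2), \<rho> 4] (l3-1) * xpow [\<rho> 4] (l4-1))
         + (\<Sum>\<nu>\<in>B4.
            xpow [\<nu> 1, 3] (l1-1) * xpow [2, \<nu> 3] (l2-1) * xpow [\<nu> 3] (l3-1) * xpow [\<nu> 4] (l4-1))
         + xpow [4,1] (l1-1) * xpow [1] (l2-1) * xpow [2] (l3-1) * xpow [3] (l4-1)
         - xpow [1] (l1-1) * xpow [2] (l2-1) * xpow [3] (l3-1) * xpow [4] (l4-1)))"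

end

theory Submission
  imports
    Defs
    "HOL-Analysis.FPS_Convergence"
    "HOL-Real_Asymp.Real_Asymp"
begin

text \<open>
  Put \<open>a\<^sub>i = n\<^sub>i - x\<^sub>i\<close>. Expanding the product of the factors \<open>1 - [n\<^sub>i > n\<^bsub>i+1\<^esub>]\<close> over the four cyclic
  neighbours gives \<open>[n\<^sub>1 = n\<^sub>2 = n\<^sub>3 = n\<^sub>4]\<close>, and multiplying by \<open>1 / (a\<^sub>1 a\<^sub>2 a\<^sub>3 a\<^sub>4)\<close> and summing over the
  \<open>n\<^sub>i\<close> turns the expansion into an alternating sum of products of generating functions of multiple
  zeta values. With all \<open>n\<^sub>i\<close> bounded by \<open>N\<close> this alternating sum is exactly the truncation of
  \<open>\<Sum>\<^sub>n 1 / ((n - x\<^sub>1) (n - x\<^sub>2) (n - x\<^sub>3) (n - x\<^sub>4))\<close>, the generating function of the right-hand side.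
  If the products are instead regularised by \<open>z\<^sup>n\<close> and expanded by the shuffle relation, one obtains the
  combination defining \<open>wpoly\<close>.

  The two regularisations differ only by polynomials in a logarithmically divergent quantity that
  do not depend on the \<open>x\<^sub>i\<close>, and their effect on the alternating sum is an additive constant, which
  only touches weight 4. The limit \<open>z \<longlonglongrightarrow> 1\<close> exists since the coefficients \<open>wpoly 1 l2 l3 l4\<close> vanish.
  Comparing the homogeneous parts in \<open>x\<close> yields the identity in each weight above 4.
\<close>

section \<open>Truncated nested sums\<close>

text \<open>Each factor of the alternating sums may diverge like a power of a logarithm, so a
  vanishing error in its asymptotics is not enough: errors get multiplied by divergent factors. All
  comparisons therefore carry a power-law rate, n^(-1/2) for truncation and (1 - z)^(1/4) for power
  series, which beats every power of the logarithm. Both regularisations get the same constants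
  because the coefficients of the power series are the summands of the truncated sums. The
  cancellations rest on one pairing: whenever linking or unlinking two cyclic neighbours does not
  change the product of the remaining factors, the two terms cancel. This removes the mixed terms
  with divergent quantities, and it makes the words cancel once their first letters are removed.
  Indeterminates are replaced by reals of absolute value at most 1/8: a letter of a shuffled word is
  a sum of at most four of them, hence at most 1/2, and each denominator n - x stays at least n /
  2.\<close>

primrec hsum :: "real list \<Rightarrow> nat \<Rightarrow> real" where
  "hsum [] n = 1"
| "hsum (x # xs) n = (\<Sum>m<n. hsum xs m / (real (Suc m) - x))"

text \<open>The sum of \<open>(-1)\<^bsup>|E|\<^esup>\<close> times a product of chains, over the sets \<open>E\<close> of cyclic descents.\<close>

definition cyclic_alt :: "(real list \<Rightarrow> 'a::comm_ring_1) \<Rightarrow> real \<Rightarrow> real \<Rightarrow> real \<Rightarrow> real \<Rightarrow> 'a" where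
  "cyclic_alt M a b c d =
     M [a] * M [b] * M [c] * M [d]
     - (M [a,b] * M [c] * M [d] + M [b,c] * M [d] * M [a]
        + M [c,d] * M [a] * M [b] + M [d,a] * M [b] * M [c])
     + (M [a,b,c] * M [d] + M [b,c,d] * M [a] + M [c,d,a] * M [b] + M [d,a,b] * M [c])
     + (M [a,b] * M [c,d] + M [b,c] * M [d,a])
     - (M [a,b,c,d] + M [b,c,d,a] + M [c,d,a,b] + M [d,a,b,c])"

text \<open>The new layer pairs the kernel at n + 1 with the inner sum cut off at n, so consecutive
  summation variables decrease strictly. The reciprocal stands as a factor so that it can be folded
  into a single ring variable.\<close>

lemma hsum_Cons_Suc:
  "hsum (x # xs) (Suc n) = hsum (x # xs) n + hsum xs n * (1 / (real (Suc n) - x))"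
  by simp

lemma hsum_Nil: "hsum [] n = 1"
  by simp

lemma hsum_Cons_0: "hsum (x # xs) 0 = 0"
  by simp

text \<open>Raising the cutoff adds the configurations in which some of the four variables take the
  new largest value. Unless all four do, some variable takes it while its cyclic successor does not,
  and linking or unlinking this pair cancels the contribution. In the induction step
  \<open>algebra\<close> checks this cancellation as a polynomial identity.\<close>

lemma cyclic_alt_hsum:
  "cyclic_alt (\<lambda>xs. hsum xs n) a b c d =
     (\<Sum>m<n. 1 / ((real (Suc m) - a) * (real (Suc m) - b) * (real (Suc m) - c) * (real (Suc m) - d)))"
proof (induction n)
  case 0
  show ?case by (simp add: cyclic_alt_def hsum_Cons_0)
next
  case (Suc n)
  define p q r s where pqrs: "p = 1 / (real (Suc n) - a)" "q = 1 / (real (Suc n) - b)"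
    "r = 1 / (real (Suc n) - c)" "s = 1 / (real (Suc n) - d)"
  have "cyclic_alt (\<lambda>xs. hsum xs (Suc n)) a b c d
      = cyclic_alt (\<lambda>xs. hsum xs n) a b c d + p * q * r * s"
    unfolding cyclic_alt_def hsum_Cons_Suc pqrs[symmetric] hsum_Nil by algebra
  then show ?case
    by (simp add: Suc.IH pqrs)
qed

section \<open>Growth and rates of convergence of the truncated sums\<close>

lemma half_le_diff: "\<bar>x\<bar> \<le> 1/2 \<Longrightarrow> real (Suc m) / 2 \<le> real (Suc m) - x"
  by (simp add: abs_le_iff)

lemma sum_inverse_sqrt_le: "(\<Sum>m<n. 1 / sqrt (real (Suc m))) \<le> 2 * sqrt (real n)"
proof (induction n)
  case (Suc n)
  define u v where uv: "u = sqrt (real n)" "v = sqrt (real (Suc n))"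
  have v: "v > 0" "u \<ge> 0" "v^2 = u^2 + 1" by (auto simp: uv)
  have "0 \<le> (u - v)^2" by simp
  then have "1 \<le> (2 * v - 2 * u) * v" using v by (simp add: algebra_simps power2_eq_square)
  then have "1 / v \<le> 2 * v - 2 * u" using v by (simp only: divide_le_eq) simp
  then show ?case using Suc by (simp add: uv)
qed simp

text \<open>With u and v the roots of n and n + 1, the left side is n^(-3/2), and the bound makes
  the tail of that series telescope. The 4 comes from \<open>v \<le> 2 * u\<close> and v^2 <= 2 u^2,
  which give v^2 + u v <= 4 u^2.\<close>

lemma sqrt_diff_ge:
  fixes u v :: real
  assumes "u > 0" "v > 0" "v^2 = u^2 + 1" "u^2 \<ge> 1"
  shows "1 / (u^2 * u) \<le> 4 * (1 / u - 1 / v)"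
proof -
  have "v \<le> 2 * u"
    by (rule power2_le_imp_le) (use assms in \<open>auto simp: power_mult_distrib\<close>)
  have e: "(v - u) * (v + u) = 1" using assms by (simp add: power2_eq_square algebra_simps)
  then have "v - u > 0" using assms by (smt (verit) zero_less_mult_iff)
  have "u * v \<le> u * (2 * u)"
    using \<open>v \<le> 2 * u\<close> assms by (intro mult_left_mono) auto
  then have "v^2 + u * v \<le> 4 * u^2" using assms(3,4) unfolding power2_eq_square by linarith
  then have "(v - u) * (v^2 + u * v) \<le> (v - u) * (4 * u^2)"
    using \<open>v - u > 0\<close> by (intro mult_left_mono) auto
  moreover have "(v - u) * (v^2 + u * v) = v * ((v - u) * (v + u))" by algebra
  ultimately have "v \<le> 4 * u^2 * (v - u)" by (simp add: e mult.commute)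
  then have "v / (u^2 * u * v) \<le> 4 * u^2 * (v - u) / (u^2 * u * v)"
    using assms by (intro divide_right_mono) auto
  moreover have "v / (u^2 * u * v) = 1 / (u^2 * u)" using assms by simp
  moreover have "4 * u^2 * (v - u) / (u^2 * u * v) = 4 * (1 / u - 1 / v)"
    using assms by (simp add: diff_divide_distrib right_diff_distrib)
  ultimately show ?thesis by simp
qed

lemma inverse_pow32_le:
  "1 / (real (Suc m) * sqrt (real (Suc m))) \<le> 4 * (1 / sqrt (real (Suc m)) - 1 / sqrt (real (Suc (Suc m))))"
  using sqrt_diff_ge[of "sqrt (real (Suc m))" "sqrt (real (Suc (Suc m)))"] by simp

text \<open>The explicit order n^(-1/2) of the tail is the point: it still tends to 0 after
  multiplication by any power of ln n.\<close>

lemma summable_pow32_bound: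
  fixes f :: "nat \<Rightarrow> real"
  assumes "\<And>m. \<bar>f m\<bar> \<le> C / (real (Suc m) * sqrt (real (Suc m)))"
  shows "summable (\<lambda>m. \<bar>f m\<bar>)" and "\<bar>suminf f - (\<Sum>m<n. f m)\<bar> \<le> 4 * C / sqrt (real (Suc n))"
proof -
  have C: "C \<ge> 0" using assms[of 0] by simp
  let ?g = "\<lambda>m. 1 / sqrt (real (Suc m))"
  have lim: "?g \<longlonglongrightarrow> 0" by real_asymp
  have tele: "(\<lambda>m. 4 * C * (?g (m + n) - ?g (Suc (m + n)))) sums (4 * C * (?g n - 0))" for n
    using sums_mult[OF telescope_sums'[OF LIMSEQ_ignore_initial_segment[OF lim, of n]], of "4*C"] by simp
  have le: "\<bar>f m\<bar> \<le> 4 * C * (?g m - ?g (Suc m))" for m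
  proof -
    have "\<bar>f m\<bar> \<le> C * (1 / (real (Suc m) * sqrt (real (Suc m))))" using assms[of m] by simp
    also have "\<dots> \<le> C * (4 * (?g m - ?g (Suc m)))"
      by (intro mult_left_mono inverse_pow32_le C)
    finally show ?thesis by (simp add: algebra_simps)
  qed
  show sm: "summable (\<lambda>m. \<bar>f m\<bar>)"
    by (rule summable_comparison_test'[OF sums_summable[OF tele[of 0]], of 0]) (use le in auto)
  have sf: "summable f" using sm by (rule summable_rabs_cancel)
  have "suminf f - (\<Sum>m<n. f m) = suminf (\<lambda>m. f (m + n))"
    using suminf_minus_initial_segment[OF sf, of n] by simp
  moreover have "\<bar>suminf (\<lambda>m. f (m + n))\<bar> \<le> suminf (\<lambda>m. \<bar>f (m + n)\<bar>)"
    by (rule summable_rabs) (use sm summable_iff_shift[of "\<lambda>m. \<bar>f m\<bar>" n] in simp)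
  moreover have "suminf (\<lambda>m. \<bar>f (m + n)\<bar>) \<le> 4 * C * (?g n - 0)"
    by (rule suminf_le[OF _ _ sums_summable[OF tele[of n]], unfolded sums_unique[OF tele[of n], symmetric]])
       (use sm summable_iff_shift[of "\<lambda>m. \<bar>f m\<bar>" n] le in \<open>auto simp del: of_nat_Suc\<close>)
  ultimately show "\<bar>suminf f - (\<Sum>m<n. f m)\<bar> \<le> 4 * C / sqrt (real (Suc n))" by simp
qed

definition small :: "real list \<Rightarrow> bool" where
  "small xs \<longleftrightarrow> (\<forall>x\<in>set xs. \<bar>x\<bar> \<le> 1/2)"

lemma small_simps [simp]: "small []" "small (x # xs) \<longleftrightarrow> \<bar>x\<bar> \<le> 1/2 \<and> small xs"
  by (auto simp: small_def)

text \<open>The true order is a power of ln n. The square root is weaker but reproduces itself: sqrt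
  m divided by a kernel of order m leaves m^(-1/2), whose partial sums are again O(sqrt n).\<close>

lemma hsum_bound: "small xs \<Longrightarrow> \<exists>C\<ge>0. \<forall>n. \<bar>hsum xs n\<bar> \<le> C * sqrt (real (Suc n))"
proof (induction xs)
  case Nil
  show ?case by (rule exI[of _ 1]) auto
next
  case (Cons x xs)
  then obtain C where C: "C \<ge> 0" "\<And>n. \<bar>hsum xs n\<bar> \<le> C * sqrt (real (Suc n))" by auto
  have x: "\<bar>x\<bar> \<le> 1/2" using Cons.prems by simp
  have "\<bar>hsum (x # xs) n\<bar> \<le> 4 * C * sqrt (real (Suc n))" for n
  proof -
    have "\<bar>hsum (x # xs) n\<bar> \<le> (\<Sum>m<n. \<bar>hsum xs m / (real (Suc m) - x)\<bar>)"
      unfolding hsum.simps by (rule sum_abs)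
    also have "\<dots> \<le> (\<Sum>m<n. 2 * C * (1 / sqrt (real (Suc m))))"
    proof (rule sum_mono)
      fix m
      have "\<bar>hsum xs m / (real (Suc m) - x)\<bar> = \<bar>hsum xs m\<bar> / (real (Suc m) - x)"
        using half_le_diff[OF x, of m] by (simp add: abs_divide)
      also have "\<dots> \<le> (C * sqrt (real (Suc m))) / (real (Suc m) / 2)"
        by (rule frac_le) (use C half_le_diff[OF x, of m] in auto)
      also have "\<dots> = 2 * C * (sqrt (real (Suc m)) / real (Suc m))" by simp
      also have "\<dots> = 2 * C * (1 / sqrt (real (Suc m)))"
        using sqrt_divide_self_eq[of "real (Suc m)"] by (simp add: inverse_eq_divide)
      finally show "\<bar>hsum xs m / (real (Suc m) - x)\<bar> \<le> 2 * C * (1 / sqrt (real (Suc m)))" .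
    qed
    also have "\<dots> = 2 * C * (\<Sum>m<n. 1 / sqrt (real (Suc m)))" by (simp add: sum_distrib_left)
    also have "\<dots> \<le> 2 * C * (2 * sqrt (real n))"
      by (intro mult_left_mono sum_inverse_sqrt_le) (use C in auto)
    also have "\<dots> \<le> 4 * C * sqrt (real (Suc n))" using C by (simp add: mult_left_mono)
    finally show ?thesis .
  qed
  then show ?case using C by (intro exI[of _ "4 * C"]) auto
qed

text \<open>
  \<open>hreg\<close> replaces every kernel \<open>1 / (m - x)\<close> by \<open>1 / m\<close> and puts the resulting convergent difference into
  the constant term; it is therefore a combination of the sums with all parameters 0.
\<close>

primrec hreg :: "real list \<Rightarrow> nat \<Rightarrow> real" where
  "hreg [] n = 1"
| "hreg (x # xs) n =
     suminf (\<lambda>m. hsum xs m / (real (Suc m) - x) - hreg xs m / real (Suc m))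
     + (\<Sum>m<n. hreg xs m / real (Suc m))"

definition hdefect :: "real \<Rightarrow> real list \<Rightarrow> nat \<Rightarrow> real" where
  "hdefect x xs m = hsum xs m / (real (Suc m) - x) - hreg xs m / real (Suc m)"

lemma hdefect_bound_step:
  assumes "small (x # xs)" "C \<ge> 0" "\<And>n. \<bar>hsum xs n - hreg xs n\<bar> \<le> C / sqrt (real (Suc n))"
  shows "\<exists>D\<ge>0. \<forall>m. \<bar>hdefect x xs m\<bar> \<le> D / (real (Suc m) * sqrt (real (Suc m)))"
proof -
  have x: "\<bar>x\<bar> \<le> 1/2" using assms by simp
  obtain B where B: "B \<ge> 0" "\<And>n. \<bar>hsum xs n\<bar> \<le> B * sqrt (real (Suc n))"
    using hsum_bound[of xs] assms(1) by auto
  have "\<bar>hdefect x xs m\<bar> \<le> (B + C) / (real (Suc m) * sqrt (real (Suc m)))" for m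
  proof -
    let ?N = "real (Suc m)"
    have d: "?N - x > 0" using half_le_diff[OF x, of m] by simp
    \<comment> \<open>The two summands separate the two replacements. Exchanging the kernel costs
      O(1/N^2), against an inner sum of size sqrt N; exchanging the inner sum costs O(N^(-1/2)),
      against the kernel 1/N. Both leave N^(-3/2).\<close>
    have eq: "hdefect x xs m = hsum xs m * (x / (?N - x)) / ?N + (hsum xs m - hreg xs m) / ?N"
      using d unfolding hdefect_def by (simp add: divide_simps) (simp add: algebra_simps)
    have "\<bar>x / (?N - x)\<bar> = \<bar>x\<bar> / (?N - x)" using d by simp
    also have "\<dots> \<le> (1/2) / (?N / 2)"
      by (rule frac_le) (use x half_le_diff[OF x, of m] in auto)
    finally have "\<bar>x / (?N - x)\<bar> \<le> 1 / ?N" by simp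
    then have "\<bar>hsum xs m * (x / (?N - x)) / ?N\<bar> \<le> B * sqrt ?N * (1 / ?N) / ?N"
      unfolding abs_mult abs_divide[of _ ?N] abs_of_nat using B by (intro divide_right_mono mult_mono) auto
    also have "\<dots> = B * (sqrt ?N / ?N) / ?N" by simp
    also have "\<dots> = B / (?N * sqrt ?N)"
      unfolding sqrt_divide_self_eq[OF of_nat_0_le_iff] by (simp add: inverse_eq_divide mult.commute)
    finally have 1: "\<bar>hsum xs m * (x / (?N - x)) / ?N\<bar> \<le> B / (?N * sqrt ?N)" .
    have "\<bar>(hsum xs m - hreg xs m) / ?N\<bar> = \<bar>hsum xs m - hreg xs m\<bar> / ?N"
      by (simp only: abs_divide abs_of_nat)
    also have "\<dots> \<le> (C / sqrt ?N) / ?N"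
      using assms(3)[of m] by (intro divide_right_mono) auto
    finally have 2: "\<bar>(hsum xs m - hreg xs m) / ?N\<bar> \<le> C / (?N * sqrt ?N)" by (simp add: mult.commute)
    show ?thesis using 1 2 unfolding eq add_divide_distrib by linarith
  qed
  then show ?thesis using B assms(2) by (intro exI[of _ "B + C"]) auto
qed

text \<open>With the constant chosen in \<open>hreg\<close>, the difference is exactly minus a tail
  of the series of \<open>hdefect\<close>, hence O(n^(-1/2)). That in turn bounds the next
  \<open>hdefect\<close> by O(m^(-3/2)), which closes the induction.\<close>

lemma hsum_hreg_bound:
  "small xs \<Longrightarrow> \<exists>C\<ge>0. \<forall>n. \<bar>hsum xs n - hreg xs n\<bar> \<le> C / sqrt (real (Suc n))"
proof (induction xs)
  case (Cons x xs)
  then obtain C where C: "C \<ge> 0" "\<And>n. \<bar>hsum xs n - hreg xs n\<bar> \<le> C / sqrt (real (Suc n))" by auto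
  from hdefect_bound_step[OF Cons.prems C] obtain D
    where D: "D \<ge> 0" "\<And>m. \<bar>hdefect x xs m\<bar> \<le> D / (real (Suc m) * sqrt (real (Suc m)))" by auto
  have eq: "hsum (x # xs) n - hreg (x # xs) n = - (suminf (hdefect x xs) - (\<Sum>m<n. hdefect x xs m))" for n
    by (simp add: hdefect_def[abs_def] sum_subtractf del: of_nat_Suc)
  show ?case
    using summable_pow32_bound(2)[OF D(2)] D(1) unfolding eq abs_minus_cancel
    by (intro exI[of _ "4 * D"]) auto
qed (auto intro: exI[of _ 0])

lemma hdefect_bound:
  assumes "small (x # xs)"
  shows "\<exists>D\<ge>0. \<forall>m. \<bar>hdefect x xs m\<bar> \<le> D / (real (Suc m) * sqrt (real (Suc m)))"
  using hsum_hreg_bound[of xs] hdefect_bound_step[OF assms] assms by auto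

section \<open>The shuffle relation\<close>

text \<open>Formally this is z^x times the integral from 0 to z of t^(-x) f(t) / (1 - t) dt, a
  twisted form of the iterated integrals for polylogarithms. Working with coefficients avoids the
  fractional powers.\<close>

definition shint :: "real \<Rightarrow> real fps \<Rightarrow> real fps" where
  "shint x f = Abs_fps (\<lambda>n. if n = 0 then 0 else (\<Sum>j<n. fps_nth f j) / (real n - x))"

definition polylog :: "real list \<Rightarrow> real fps" where
  "polylog xs = foldr shint xs 1"

lemma polylog_simps [simp]: "polylog [] = 1" "polylog (x # xs) = shint x (polylog xs)"
  by (simp_all add: polylog_def)

lemma fps_nth_X_deriv: "fps_nth (fps_X * fps_deriv f) n = of_nat n * fps_nth (f :: real fps) n"
  by (cases n) auto

lemma fps_nth_X_geometric:
  "fps_nth (fps_X * (Abs_fps (\<lambda>_. 1) * f)) n = (\<Sum>j<n. fps_nth (f :: real fps) j)"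
proof -
  have "fps_nth (Abs_fps (\<lambda>_. 1) * f) m = (\<Sum>j\<le>m. fps_nth f j)" for m
    by (subst mult.commute) (simp add: fps_mult_nth atLeast0AtMost)
  then show ?thesis by (cases n) (simp_all add: lessThan_Suc_atMost)
qed

text \<open>Clearing the denominators n - x turns the coefficients into the equation z F' - x F = z
  f / (1 - z); the bound on x keeps them nonzero for n > 0. The constant term is a separate
  condition because for x = 0 the equation does not see it.\<close>

lemma shint_iff:
  assumes "\<bar>x\<bar> < 1"
  shows "F = shint x f \<longleftrightarrow>
    fps_nth F 0 = 0 \<and> fps_X * fps_deriv F - fps_const x * F = fps_X * (Abs_fps (\<lambda>_. 1) * f)"
proof -
  have "real n - x \<noteq> 0" if "n > 0" for n using assms that by (simp add: abs_less_iff)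
  then have "(n = 0 \<longrightarrow> fps_nth F n = 0) \<and> (real n - x) * fps_nth F n = (\<Sum>j<n. fps_nth f j)
     \<longleftrightarrow> fps_nth F n = fps_nth (shint x f) n" for n
    by (cases "n = 0") (auto simp: shint_def field_simps)
  then show ?thesis
    unfolding fps_eq_iff fps_sub_nth fps_nth_X_geometric fps_nth_X_deriv fps_mult_left_const_nth left_diff_distrib[symmetric]
    by metis
qed

text \<open>The operator \<open>z d/dz\<close> is a derivation; this is the source of the shuffle relation.\<close>

lemma shint_mult:
  assumes "\<bar>x\<bar> + \<bar>y\<bar> < 1"
  shows "shint x f * shint y g = shint (x + y) (f * shint y g + shint x f * g)"
proof -
  define F G W where FG: "F = shint x f" "G = shint y g" "W = Abs_fps (\<lambda>_. 1::real)"
  have F: "fps_nth F 0 = 0" "fps_X * fps_deriv F = fps_const x * F + fps_X * (W * f)"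
    using shint_iff[of x F f] assms by (auto simp: FG algebra_simps)
  have G: "fps_nth G 0 = 0" "fps_X * fps_deriv G = fps_const y * G + fps_X * (W * g)"
    using shint_iff[of y G g] assms by (auto simp: FG algebra_simps)
  have "fps_X * fps_deriv (F * G) = (fps_X * fps_deriv F) * G + F * (fps_X * fps_deriv G)"
    by (simp add: algebra_simps)
  then have "fps_X * fps_deriv (F * G) - fps_const (x + y) * (F * G) = fps_X * (W * (f * G + F * g))"
    unfolding F(2) G(2) by (simp add: algebra_simps fps_const_add[symmetric] del: fps_const_add)
  then show ?thesis
    using assms F(1) unfolding FG(1,2)[symmetric] by (subst shint_iff) (auto simp: FG(3))
qed

text \<open>The twists add, so the first letter of a product is the sum of both first letters. This
  is the origin of the sums of indeterminates in \<open>wpoly\<close>.\<close>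

lemma polylog_shuffle:
  assumes "\<bar>x\<bar> + \<bar>y\<bar> < 1"
  shows "polylog (x # xs) * polylog (y # ys) =
    shint (x + y) (polylog xs * polylog (y # ys) + polylog (x # xs) * polylog ys)"
  using shint_mult[OF assms] by simp

lemma shint_add: "shint x (f + g) = shint x f + shint x g"
  by (simp add: fps_eq_iff shint_def sum.distrib add_divide_distrib)

lemma polylog_mult_1_1:
  assumes "\<bar>a\<bar> + \<bar>b\<bar> < 1"
  shows "polylog [a] * polylog [b] = polylog [a + b, b] + polylog [a + b, a]"
  unfolding polylog_shuffle[OF assms] polylog_simps(1) by (simp add: shint_add)

lemma polylog_mult_2_1:
  assumes "\<bar>a\<bar> + \<bar>c\<bar> < 1" "\<bar>b\<bar> + \<bar>c\<bar> < 1"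
  shows "polylog [a, b] * polylog [c] =
    polylog [a + c, b + c, c] + polylog [a + c, b + c, b] + polylog [a + c, a, b]"
  unfolding polylog_shuffle[OF assms(1)] polylog_mult_1_1[OF assms(2)] polylog_simps(1) by (simp add: shint_add)

lemma polylog_mult_3_1:
  assumes "\<bar>a\<bar> + \<bar>d\<bar> < 1" "\<bar>b\<bar> + \<bar>d\<bar> < 1" "\<bar>c\<bar> + \<bar>d\<bar> < 1"
  shows "polylog [a, b, c] * polylog [d] =
    polylog [a + d, b + d, c + d, d] + polylog [a + d, b + d, c + d, c]
    + polylog [a + d, b + d, b, c] + polylog [a + d, a, b, c]"
  unfolding polylog_shuffle[OF assms(1)] polylog_mult_2_1[OF assms(2,3)] polylog_simps(1) by (simp add: shint_add)

lemma polylog_mult_2_2: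
  assumes "\<bar>a\<bar> + \<bar>c\<bar> < 1" "\<bar>b\<bar> + \<bar>c\<bar> < 1" "\<bar>a\<bar> + \<bar>d\<bar> < 1" "\<bar>b\<bar> + \<bar>d\<bar> < 1"
  shows "polylog [a, b] * polylog [c, d] =
    polylog [a + c, b + c, b + d, d] + polylog [a + c, b + c, b + d, b]
    + polylog [a + c, b + c, c, d] + polylog [a + c, a + d, b + d, d]
    + polylog [a + c, a + d, b + d, b] + polylog [a + c, a + d, a, b]"
proof -
  have "polylog [b] * polylog [c, d] = polylog [c, d] * polylog [b]" by (rule mult.commute)
  also have "\<dots> = polylog [c + b, d + b, b] + polylog [c + b, d + b, d] + polylog [c + b, c, d]"
    by (rule polylog_mult_2_1) (use assms in linarith)+
  finally show ?thesis
    unfolding polylog_shuffle[OF assms(1)] polylog_mult_2_1[OF assms(3,4)] by (simp add: shint_add add_ac)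
qed

text \<open>
  The words occurring in the shuffle product of chains of the indicated lengths: an entry
  \<open>(p, q, r, s)\<close> stands for \<open>polylog [p, q, r, s]\<close>.
\<close>

definition words1111 :: "real \<Rightarrow> real \<Rightarrow> real \<Rightarrow> real \<Rightarrow> (real \<times> real \<times> real \<times> real) list" where
  "words1111 a b c d =
     map (Pair (a + b + c + d)) (concat (map (\<lambda>(p, q, r). map (Pair (p + q + r))
       [(q + r, r), (q + r, q), (p + r, r), (p + r, p), (p + q, q), (p + q, p)])
       [(b, c, d), (a, c, d), (a, b, d), (a, b, c)]))"

definition words211 :: "real \<Rightarrow> real \<Rightarrow> real \<Rightarrow> real \<Rightarrow> (real \<times> real \<times> real \<times> real) list" where
  "words211 a b c d = map (Pair (a + c + d))
     [(b + c + d, c + d, d), (b + c + d, c + d, c), (b + c + d, b + d, d), (b + c + d, b + d, b),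
      (b + c + d, b + c, c), (b + c + d, b + c, b),
      (a + d, b + d, d), (a + d, b + d, b), (a + d, a, b),
      (a + c, b + c, c), (a + c, b + c, b), (a + c, a, b)]"

definition words31 :: "real \<Rightarrow> real \<Rightarrow> real \<Rightarrow> real \<Rightarrow> (real \<times> real \<times> real \<times> real) list" where
  "words31 a b c d = map (Pair (a + d))
     [(b + d, c + d, d), (b + d, c + d, c), (b + d, b, c), (a, b, c)]"

definition words22 :: "real \<Rightarrow> real \<Rightarrow> real \<Rightarrow> real \<Rightarrow> (real \<times> real \<times> real \<times> real) list" where
  "words22 a b c d = map (Pair (a + c))
     [(b + c, b + d, d), (b + c, b + d, b), (b + c, c, d), (a + d, b + d, d), (a + d, b + d, b), (a + d, a, b)]"

text \<open>The signed words are kept as data because the same combination is evaluated in several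
  rings: at power series, at their values, at generating functions and at monomials. A list keeps
  the multiplicity of words that coincide for special parameters.\<close>

definition altwords :: "real \<Rightarrow> real \<Rightarrow> real \<Rightarrow> real \<Rightarrow> (int \<times> real \<times> real \<times> real \<times> real) list" where
  "altwords a b c d =
     map (Pair 1) (words1111 a b c d)
     @ map (Pair (-1)) (words211 a b c d @ words211 b c d a @ words211 c d a b @ words211 d a b c)
     @ map (Pair 1) (words31 a b c d @ words31 b c d a @ words31 c d a b @ words31 d a b c
         @ words22 a b c d @ words22 b c d a)
     @ map (Pair (-1)) [(a, b, c, d), (b, c, d, a), (c, d, a, b), (d, a, b, c)]"

definition altsum :: "(real \<Rightarrow> real \<Rightarrow> real \<Rightarrow> real \<Rightarrow> 'a::comm_ring_1) \<Rightarrow> real \<Rightarrow> real \<Rightarrow> real \<Rightarrow> real \<Rightarrow> 'a" where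
  "altsum F a b c d = (\<Sum>(e, p, q, r, s)\<leftarrow>altwords a b c d. of_int e * F p q r s)"

lemma polylog_mult_2_1_1:
  assumes "\<bar>a\<bar> \<le> 1/8" "\<bar>b\<bar> \<le> 1/8" "\<bar>c\<bar> \<le> 1/8" "\<bar>d\<bar> \<le> 1/8"
  shows "polylog [a, b] * polylog [c] * polylog [d] = (\<Sum>(p, q, r, s)\<leftarrow>words211 a b c d. polylog [p, q, r, s])"
proof -
  have 1: "polylog [a, b] * polylog [c] =
    polylog [a + c, b + c, c] + polylog [a + c, b + c, b] + polylog [a + c, a, b]"
    by (rule polylog_mult_2_1) (use assms in linarith)+
  have 2: "polylog [a + c, b + c, c] * polylog [d] =
    polylog [a + c + d, b + c + d, c + d, d] + polylog [a + c + d, b + c + d, c + d, c]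
    + polylog [a + c + d, b + c + d, b + c, c] + polylog [a + c + d, a + c, b + c, c]"
    by (rule polylog_mult_3_1) (use assms in linarith)+
  have 3: "polylog [a + c, b + c, b] * polylog [d] =
    polylog [a + c + d, b + c + d, b + d, d] + polylog [a + c + d, b + c + d, b + d, b]
    + polylog [a + c + d, b + c + d, b + c, b] + polylog [a + c + d, a + c, b + c, b]"
    by (rule polylog_mult_3_1) (use assms in linarith)+
  have 4: "polylog [a + c, a, b] * polylog [d] =
    polylog [a + c + d, a + d, b + d, d] + polylog [a + c + d, a + d, b + d, b]
    + polylog [a + c + d, a + d, a, b] + polylog [a + c + d, a + c, a, b]"
    by (rule polylog_mult_3_1) (use assms in linarith)+
  show ?thesis
    unfolding 1 distrib_right 2 3 4 words211_def by (simp del: polylog_simps)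
qed

lemma polylog_mult_1_1_1_1:
  assumes "\<bar>a\<bar> \<le> 1/8" "\<bar>b\<bar> \<le> 1/8" "\<bar>c\<bar> \<le> 1/8" "\<bar>d\<bar> \<le> 1/8"
  shows "polylog [a] * polylog [b] * polylog [c] * polylog [d] =
    (\<Sum>(p, q, r, s)\<leftarrow>words1111 a b c d. polylog [p, q, r, s])"
proof -
  have 1: "polylog [a] * polylog [b] = polylog [a + b, b] + polylog [a + b, a]"
    by (rule polylog_mult_1_1) (use assms in linarith)
  have 2: "polylog [a + b, y] * polylog [c] =
    polylog [a + b + c, y + c, c] + polylog [a + b + c, y + c, y] + polylog [a + b + c, a + b, y]"
    if "\<bar>y\<bar> \<le> 1/8" for y
    by (rule polylog_mult_2_1) (use assms that in linarith)+
  have 3: "polylog [a + b + c, x, y] * polylog [d] =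
    polylog [a + b + c + d, x + d, y + d, d] + polylog [a + b + c + d, x + d, y + d, y]
    + polylog [a + b + c + d, x + d, x, y] + polylog [a + b + c + d, a + b + c, x, y]"
    if "\<bar>x\<bar> \<le> 1/4" "\<bar>y\<bar> \<le> 1/4" for x y
    by (rule polylog_mult_3_1) (use assms that in linarith)+
  have s: "\<bar>a + b\<bar> \<le> 1/4" "\<bar>a + c\<bar> \<le> 1/4" "\<bar>b + c\<bar> \<le> 1/4"
    "\<bar>a\<bar> \<le> 1/4" "\<bar>b\<bar> \<le> 1/4" "\<bar>c\<bar> \<le> 1/4"
    using assms by linarith+
  show ?thesis
    unfolding 1 distrib_right 2[OF assms(1)] 2[OF assms(2)] 3[OF s(3,6)] 3[OF s(3,5)] 3[OF s(1,5)]
      3[OF s(2,6)] 3[OF s(2,4)] 3[OF s(1,4)] words1111_def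
    by (simp add: add_ac del: polylog_simps)
qed

lemma altsum_words:
  "altsum F a b c d =
    (\<Sum>(p, q, r, s)\<leftarrow>words1111 a b c d. F p q r s)
    - ((\<Sum>(p, q, r, s)\<leftarrow>words211 a b c d. F p q r s) + (\<Sum>(p, q, r, s)\<leftarrow>words211 b c d a. F p q r s)
       + (\<Sum>(p, q, r, s)\<leftarrow>words211 c d a b. F p q r s) + (\<Sum>(p, q, r, s)\<leftarrow>words211 d a b c. F p q r s))
    + ((\<Sum>(p, q, r, s)\<leftarrow>words31 a b c d. F p q r s) + (\<Sum>(p, q, r, s)\<leftarrow>words31 b c d a. F p q r s)
       + (\<Sum>(p, q, r, s)\<leftarrow>words31 c d a b. F p q r s) + (\<Sum>(p, q, r, s)\<leftarrow>words31 d a b c. F p q r s))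
    + ((\<Sum>(p, q, r, s)\<leftarrow>words22 a b c d. F p q r s) + (\<Sum>(p, q, r, s)\<leftarrow>words22 b c d a. F p q r s))
    - (F a b c d + F b c d a + F c d a b + F d a b c)"
proof -
  have neg: "(\<Sum>(e, p, q, r, s)\<leftarrow>map (Pair (-1)) ws. of_int e * F p q r s) = - (\<Sum>(p, q, r, s)\<leftarrow>ws. F p q r s)"
    and pos: "(\<Sum>(e, p, q, r, s)\<leftarrow>map (Pair 1) ws. of_int e * F p q r s) = (\<Sum>(p, q, r, s)\<leftarrow>ws. F p q r s)"
    for ws
    by (induction ws) auto
  show ?thesis
    unfolding altsum_def altwords_def map_append[of "case_prod _"] sum_list_append pos neg
    by (simp add: sum_list_append)
qed

lemma cyclic_alt_polylog:
  assumes "\<bar>a\<bar> \<le> 1/8" "\<bar>b\<bar> \<le> 1/8" "\<bar>c\<bar> \<le> 1/8" "\<bar>d\<bar> \<le> 1/8"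
  shows "cyclic_alt polylog a b c d = altsum (\<lambda>p q r s. polylog [p, q, r, s]) a b c d"
proof -
  have 31: "polylog [a, b, c] * polylog [d] = (\<Sum>(p, q, r, s)\<leftarrow>words31 a b c d. polylog [p, q, r, s])"
    if "\<bar>a\<bar> \<le> 1/8" "\<bar>b\<bar> \<le> 1/8" "\<bar>c\<bar> \<le> 1/8" "\<bar>d\<bar> \<le> 1/8" for a b c d
    by (subst polylog_mult_3_1) (use that in \<open>auto simp: words31_def simp del: polylog_simps\<close>)
  have 22: "polylog [a, b] * polylog [c, d] = (\<Sum>(p, q, r, s)\<leftarrow>words22 a b c d. polylog [p, q, r, s])"
    if "\<bar>a\<bar> \<le> 1/8" "\<bar>b\<bar> \<le> 1/8" "\<bar>c\<bar> \<le> 1/8" "\<bar>d\<bar> \<le> 1/8" for a b c d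
    by (subst polylog_mult_2_2) (use that in \<open>auto simp: words22_def simp del: polylog_simps\<close>)
  show ?thesis
    unfolding cyclic_alt_def altsum_words polylog_mult_1_1_1_1[OF assms]
      polylog_mult_2_1_1[OF assms] polylog_mult_2_1_1[OF assms(2,3,4,1)] polylog_mult_2_1_1[OF assms(3,4,1,2)] polylog_mult_2_1_1[OF assms(4,1,2,3)]
      31[OF assms] 31[OF assms(2,3,4,1)] 31[OF assms(3,4,1,2)] 31[OF assms(4,1,2,3)]
      22[OF assms] 22[OF assms(2,3,4,1)] ..
qed

text \<open>Removing the first letter is a derivation for shuffle products, so on a product of
  chains it removes the head of each chain in turn. Once a head is removed, it no longer matters
  whether it was linked to its successor or stood alone, and these two cases have opposite signs.
  The proof compares the resulting words directly.\<close>

lemma altsum_const_first: "altsum (\<lambda>p q r s. g q r s) a b c d = 0"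
  unfolding altsum_def altwords_def words1111_def words211_def words31_def words22_def
  by (simp add: add_ac)

lemma altwords_small:
  assumes "\<bar>a\<bar> \<le> 1/8" "\<bar>b\<bar> \<le> 1/8" "\<bar>c\<bar> \<le> 1/8" "\<bar>d\<bar> \<le> 1/8" "(e, p, q, r, s) \<in> set (altwords a b c d)"
  shows "small [p, q, r, s]"
proof -
  have b: "- 1 \<le> 8 * a" "8 * a \<le> 1" "- 1 \<le> 8 * b" "8 * b \<le> 1"
    "- 1 \<le> 8 * c" "8 * c \<le> 1" "- 1 \<le> 8 * d" "8 * d \<le> 1"
    using assms(1-4) by linarith+
  have hb: "\<bar>t\<bar> * 2 \<le> 1 \<longleftrightarrow> - 1 \<le> 2 * t \<and> 2 * t \<le> 1" for t :: real
    by linarith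
  have "\<forall>(e, p, q, r, s)\<in>set (altwords a b c d). small [p, q, r, s]"
    unfolding altwords_def words1111_def words211_def words31_def words22_def
    using b by (simp add: hb)
  then show ?thesis using assms(5) by blast
qed

section \<open>Multiple polylogarithms and their behaviour at 1\<close>

text \<open>This ties the two regularisations together: the truncated sums are the partial sums of
  the coefficients, so letting z tend to 1 is Abel summation of the same data.\<close>

lemma polylog_nth:
  "(\<Sum>j<Suc m. fps_nth (polylog xs) j) = hsum xs m"
  "fps_nth (polylog (x # xs)) 0 = 0"
  "fps_nth (polylog (x # xs)) (Suc m) = hsum xs m / (real (Suc m) - x)"
proof -
  show *: "(\<Sum>j<Suc m. fps_nth (polylog xs) j) = hsum xs m" for xs m
  proof (induction xs arbitrary: m)
    case Nil
    show ?case by (induction m) auto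
  next
    case (Cons x xs)
    show ?case
      unfolding sum.lessThan_Suc_shift polylog_simps hsum.simps
      by (simp add: shint_def Cons.IH del: of_nat_Suc sum.lessThan_Suc)
  qed
  show "fps_nth (polylog (x # xs)) 0 = 0"
    "fps_nth (polylog (x # xs)) (Suc m) = hsum xs m / (real (Suc m) - x)"
    unfolding polylog_simps shint_def by (simp_all add: * del: of_nat_Suc sum.lessThan_Suc)
qed

lemma polylog_bounded:
  assumes "small (x # xs)"
  shows "\<exists>C. \<forall>n. \<bar>fps_nth (polylog (x # xs)) n\<bar> \<le> C"
proof -
  obtain C where C: "C \<ge> 0" "\<And>n. \<bar>hsum xs n\<bar> \<le> C * sqrt (real (Suc n))"
    using hsum_bound[of xs] assms by auto
  have "\<bar>fps_nth (polylog (x # xs)) n\<bar> \<le> 2 * C" for n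
  proof (cases n)
    case 0
    then show ?thesis using C(1) by (simp add: polylog_nth(2) del: polylog_simps)
  next
    case (Suc m)
    have d: "real (Suc m) / 2 \<le> real (Suc m) - x" by (rule half_le_diff) (use assms in simp)
    have "\<bar>fps_nth (polylog (x # xs)) n\<bar> = \<bar>hsum xs m\<bar> / (real (Suc m) - x)"
      unfolding Suc polylog_nth using d by (simp add: abs_divide)
    also have "\<dots> \<le> (C * real (Suc m)) / (real (Suc m) / 2)"
    proof (rule frac_le)
      have "sqrt (real (Suc m)) \<le> real (Suc m)" by (rule real_le_lsqrt) (auto simp: power2_eq_square)
      then show "\<bar>hsum xs m\<bar> \<le> C * real (Suc m)"
        using C(2)[of m] mult_left_mono[OF _ C(1)] by (meson order_trans)
    qed (use C d in auto)
    also have "\<dots> = 2 * C" by simp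
    finally show ?thesis .
  qed
  then show ?thesis by blast
qed

lemma fps_conv_radius_ge_1_bounded:
  fixes f :: "real fps"
  assumes "\<And>n. \<bar>fps_nth f n\<bar> \<le> C"
  shows "fps_conv_radius f \<ge> 1"
  unfolding fps_conv_radius_def
proof (rule conv_radius_geI_ex')
  fix r :: real assume r: "0 < r" "ereal r < 1"
  show "summable (\<lambda>n. fps_nth f n * of_real r ^ n)"
  proof (rule summable_comparison_test'[of "\<lambda>n. C * r ^ n" 0])
    show "summable (\<lambda>n. C * r ^ n)" using r by (intro summable_mult summable_geometric) auto
    show "norm (fps_nth f n * of_real r ^ n) \<le> C * r ^ n" for n
      using assms[of n] r by (simp add: abs_mult mult_right_mono)
  qed
qed

lemma polylog_radius:
  assumes "small xs"
  shows "fps_conv_radius (polylog xs) \<ge> 1"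
proof (cases xs)
  case (Cons x ys)
  then show ?thesis using polylog_bounded assms fps_conv_radius_ge_1_bounded by metis
qed simp

definition Li :: "real list \<Rightarrow> real \<Rightarrow> real" where
  "Li xs z = eval_fps (polylog xs) z"

lemma Li_Nil [simp]: "Li [] z = 1"
  by (simp add: Li_def)

lemma Li_sums:
  assumes "small (x # xs)" "\<bar>z\<bar> < 1"
  shows "(\<lambda>m. z ^ Suc m * (hsum xs m / (real (Suc m) - x))) sums Li (x # xs) z"
proof -
  have "ereal (norm z) < fps_conv_radius (polylog (x # xs))"
    by (rule less_le_trans[OF _ polylog_radius[OF assms(1)]]) (use assms in auto)
  then have "(\<lambda>n. fps_nth (polylog (x # xs)) n * z ^ n) sums Li (x # xs) z"
    unfolding Li_def by (rule sums_eval_fps)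
  then have "(\<lambda>n. fps_nth (polylog (x # xs)) (Suc n) * z ^ Suc n) sums Li (x # xs) z"
    by (subst sums_Suc_iff) (simp only: polylog_nth(2), simp)
  then show ?thesis unfolding polylog_nth by (simp add: mult.commute)
qed

lemma Li_mult:
  assumes "small xs" "small ys" "\<bar>z\<bar> < 1"
  shows "eval_fps (polylog xs * polylog ys) z = Li xs z * Li ys z"
  unfolding Li_def
  by (rule eval_fps_mult; rule less_le_trans[OF _ polylog_radius]) (use assms in auto)

text \<open>The fixed bound 1 on the radius makes the hypotheses closed under the ring operations,
  so that simplification can evaluate nested expressions.\<close>

lemma eval_fps_ring_ge_1:
  fixes f g :: "real fps"
  assumes "fps_conv_radius f \<ge> 1" "fps_conv_radius g \<ge> 1"
  shows "fps_conv_radius (f + g) \<ge> 1" "fps_conv_radius (f - g) \<ge> 1" "fps_conv_radius (f * g) \<ge> 1"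
    "\<bar>z\<bar> < 1 \<Longrightarrow> eval_fps (f + g) z = eval_fps f z + eval_fps g z"
    "\<bar>z\<bar> < 1 \<Longrightarrow> eval_fps (f - g) z = eval_fps f z - eval_fps g z"
    "\<bar>z\<bar> < 1 \<Longrightarrow> eval_fps (f * g) z = eval_fps f z * eval_fps g z"
proof -
  have m: "min (fps_conv_radius f) (fps_conv_radius g) \<ge> 1" using assms by simp
  show "fps_conv_radius (f + g) \<ge> 1" "fps_conv_radius (f - g) \<ge> 1" "fps_conv_radius (f * g) \<ge> 1"
    using m fps_conv_radius_add fps_conv_radius_diff fps_conv_radius_mult order_trans by blast+
  have r: "ereal (norm z) < fps_conv_radius f" "ereal (norm z) < fps_conv_radius g" if "\<bar>z\<bar> < 1"
    using that by (auto intro!: less_le_trans[OF _ assms(1)] less_le_trans[OF _ assms(2)])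
  show "\<bar>z\<bar> < 1 \<Longrightarrow> eval_fps (f + g) z = eval_fps f z + eval_fps g z"
    "\<bar>z\<bar> < 1 \<Longrightarrow> eval_fps (f - g) z = eval_fps f z - eval_fps g z"
    "\<bar>z\<bar> < 1 \<Longrightarrow> eval_fps (f * g) z = eval_fps f z * eval_fps g z"
    using r by (auto intro: eval_fps_add eval_fps_diff eval_fps_mult)
qed

lemma eval_fps_cyclic_alt:
  assumes "small [a, b, c, d]" "\<bar>z\<bar> < 1"
  shows "eval_fps (cyclic_alt polylog a b c d) z = cyclic_alt (\<lambda>xs. Li xs z) a b c d"
proof -
  have "fps_conv_radius (polylog xs) \<ge> 1" if "set xs \<subseteq> {a, b, c, d}" for xs
    by (rule polylog_radius) (use assms that in \<open>auto simp: small_def\<close>)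
  then show ?thesis
    unfolding cyclic_alt_def Li_def using assms(2)
    by (simp add: eval_fps_ring_ge_1 del: polylog_simps)
qed

lemma eval_fps_altsum:
  assumes "\<bar>a\<bar> \<le> 1/8" "\<bar>b\<bar> \<le> 1/8" "\<bar>c\<bar> \<le> 1/8" "\<bar>d\<bar> \<le> 1/8" "\<bar>z\<bar> < 1"
  shows "eval_fps (altsum (\<lambda>p q r s. polylog [p, q, r, s]) a b c d) z = altsum (\<lambda>p q r s. Li [p, q, r, s] z) a b c d"
proof -
  have int: "fps_conv_radius (of_int e :: real fps) \<ge> 1" "eval_fps (of_int e :: real fps) z = of_int e" for e
    by (simp_all flip: fps_of_int)
  have "fps_conv_radius (\<Sum>(e, p, q, r, s)\<leftarrow>ws. of_int e * polylog [p, q, r, s]) \<ge> 1 \<and>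
    eval_fps (\<Sum>(e, p, q, r, s)\<leftarrow>ws. of_int e * polylog [p, q, r, s]) z =
      (\<Sum>(e, p, q, r, s)\<leftarrow>ws. of_int e * Li [p, q, r, s] z)"
    if "\<forall>(e, p, q, r, s)\<in>set ws. small [p, q, r, s]" for ws
    using that
  proof (induction ws)
    case (Cons w ws)
    obtain e p q r s where w: "w = (e, p, q, r, s)" by (cases w)
    have "fps_conv_radius (polylog [p, q, r, s]) \<ge> 1"
      by (rule polylog_radius) (use Cons.prems w in auto)
    then show ?case
      using Cons by (simp add: w eval_fps_ring_ge_1 int assms(5) Li_def del: polylog_simps)
  qed simp
  then show ?thesis
    unfolding altsum_def using altwords_small[OF assms(1-4)] by blast
qed

text \<open>
  \<open>U j\<close> is the regularisation of the sum with \<open>j\<close> parameters, all 0; both regularisations of the sum with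
  parameters \<open>xs\<close> are asymptotic to \<open>hexp U xs\<close>, with the same constants.
\<close>

primrec hexp :: "(nat \<Rightarrow> real) \<Rightarrow> real list \<Rightarrow> real" where
  "hexp U [] = U 0"
| "hexp U (x # xs) = suminf (hdefect x xs) * U 0 + hexp (\<lambda>j. U (Suc j)) xs"

text \<open>\<open>hexp\<close> is linear in \<open>U\<close>. Hence summing against the kernel 1/m
  acts on \<open>U\<close> alone, for finite sums as well as for convergent series.\<close>

lemma hexp_sum: "(\<Sum>m<n. c m * hexp (U m) xs) = hexp (\<lambda>j. \<Sum>m<n. c m * U m j) xs" for c :: "nat \<Rightarrow> real"
  by (induction xs arbitrary: U) (simp_all add: algebra_simps sum.distrib sum_distrib_left)

lemma hexp_sums:
  assumes "\<And>j. (\<lambda>m. c m * U m j) sums V j"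
  shows "(\<lambda>m. c m * hexp (U m) xs) sums hexp V xs"
  using assms
proof (induction xs arbitrary: U V)
  case (Cons x xs)
  have "(\<lambda>m. suminf (hdefect x xs) * (c m * U m 0) + c m * hexp (\<lambda>j. U m (Suc j)) xs) sums hexp V (x # xs)"
    unfolding hexp.simps by (intro sums_add sums_mult Cons)
  then show ?case by (simp add: algebra_simps)
qed simp

abbreviation zeros :: "nat \<Rightarrow> real list" where
  "zeros j \<equiv> replicate j 0"

lemma small_zeros: "small (zeros j)"
  by (simp add: small_def)

lemma hreg_eq_hexp: "hreg xs n = hexp (\<lambda>j. hsum (zeros j) n) xs"
proof (induction xs arbitrary: n)
  case (Cons x xs)
  have "(\<Sum>m<n. hreg xs m / real (Suc m)) = (\<Sum>m<n. (1 / real (Suc m)) * hexp (\<lambda>j. hsum (zeros j) m) xs)"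
    by (simp add: Cons.IH)
  also have "\<dots> = hexp (\<lambda>j. hsum (zeros (Suc j)) n) xs"
    unfolding hexp_sum by simp
  finally show ?case by (simp add: hdefect_def[abs_def])
qed simp

section \<open>Abel summation with a rate\<close>

lemma one_minus_power_le:
  fixes z :: real
  assumes "0 \<le> z" "z \<le> 1"
  shows "\<bar>z ^ n - 1\<bar> \<le> (real n * (1 - z)) powr (1/4)"
proof -
  have le: "1 - z ^ n \<le> real n * (1 - z)"
    using Bernoulli_inequality[of "z - 1" n] assms by (simp add: algebra_simps)
  have eq: "\<bar>z ^ n - 1\<bar> = 1 - z ^ n" "1 - z ^ n \<le> 1" using assms by (auto simp: power_le_one)
  define t where "t = real n * (1 - z)"
  have t: "t \<ge> 0" using assms by (simp add: t_def)
  have "min 1 t \<le> t powr (1/4)"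
  proof (cases "t \<le> 1")
    case True
    have "t = t powr 1" using t by simp
    also have "\<dots> \<le> t powr (1/4)" by (rule powr_mono') (use t True in auto)
    finally show ?thesis by simp
  qed (simp add: ge_one_powr_ge_zero)
  then show ?thesis using le eq by (simp add: t_def)
qed

text \<open>The exponent 1/4 splits the decay m^(-3/2): a factor m^(1/4) pays for the estimate of
  z^m - 1, and the remaining m^(-5/4) is still summable. Any exponent strictly between 0 and 1/2
  would do.\<close>

lemma abelian_bound:
  fixes f :: "nat \<Rightarrow> real"
  assumes "\<And>m. \<bar>f m\<bar> \<le> C / (real (Suc m) * sqrt (real (Suc m)))"
  shows "\<exists>K. \<forall>z. 0 \<le> z \<and> z < 1 \<longrightarrow>
    summable (\<lambda>m. z ^ Suc m * f m) \<and> \<bar>suminf (\<lambda>m. z ^ Suc m * f m) - suminf f\<bar> \<le> K * (1 - z) powr (1/4)"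
proof (intro exI allI impI)
  fix z :: real assume z: "0 \<le> z \<and> z < 1"
  let ?g = "\<lambda>m. real (Suc m) powr (-(5/4))"
  have C: "C \<ge> 0" using assms[of 0] by simp
  have sf': "summable (\<lambda>m. \<bar>f m\<bar>)" by (rule summable_pow32_bound[OF assms])
  then have sf: "summable f" by (rule summable_rabs_cancel)
  show "summable (\<lambda>m. z ^ Suc m * f m) \<and> \<bar>suminf (\<lambda>m. z ^ Suc m * f m) - suminf f\<bar> \<le> (C * suminf ?g) * (1 - z) powr (1/4)"
  proof
    show s: "summable (\<lambda>m. z ^ Suc m * f m)"
    proof (rule summable_comparison_test'[OF sf', of 0])
      fix m show "norm (z ^ Suc m * f m) \<le> \<bar>f m\<bar>"
        unfolding real_norm_def abs_mult by (rule mult_left_le_one_le) (use z in \<open>auto simp: power_le_one abs_mult simp del: power_Suc\<close>)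
    qed
    have sg: "summable ?g"
      using summable_real_powr_iff[of "-(5/4)"] by (subst summable_Suc_iff) simp
    let ?h = "\<lambda>m. C * (1 - z) powr (1/4) * ?g m"
    have h: "summable ?h" by (intro summable_mult sg)
    have le: "\<bar>z ^ Suc m * f m - f m\<bar> \<le> ?h m" for m
    proof -
      let ?N = "real (Suc m)"
      have "\<bar>z ^ Suc m * f m - f m\<bar> = \<bar>z ^ Suc m - 1\<bar> * \<bar>f m\<bar>"
        by (simp add: abs_mult[symmetric] algebra_simps)
      also have "\<dots> \<le> (?N * (1 - z)) powr (1/4) * (C / (?N * sqrt ?N))"
        by (intro mult_mono one_minus_power_le assms) (use z in auto)
      also have "\<dots> = ?h m"
      proof -
        have "?N * sqrt ?N = ?N powr (3/2)"
          using powr_add[of ?N 1 "1/2"] by (simp add: powr_half_sqrt)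
        then have "(?N * (1 - z)) powr (1/4) * (C / (?N * sqrt ?N)) = C * (1 - z) powr (1/4) * (?N powr (1/4) / ?N powr (3/2))"
          using z by (simp add: powr_mult)
        also have "?N powr (1/4) / ?N powr (3/2) = ?g m"
          by (simp add: powr_diff[symmetric])
        finally show ?thesis .
      qed
      finally show ?thesis .
    qed
    have sd: "summable (\<lambda>m. \<bar>z ^ Suc m * f m - f m\<bar>)"
      by (rule summable_comparison_test'[OF h, of 0]) (use le in auto)
    have "\<bar>suminf (\<lambda>m. z ^ Suc m * f m) - suminf f\<bar> = \<bar>suminf (\<lambda>m. z ^ Suc m * f m - f m)\<bar>"
      using suminf_diff[OF s sf] by simp
    also have "\<dots> \<le> suminf (\<lambda>m. \<bar>z ^ Suc m * f m - f m\<bar>)"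
      by (rule summable_rabs[OF sd])
    also have "\<dots> \<le> suminf ?h"
      by (rule suminf_le[OF _ sd h]) (use le in auto)
    also have "\<dots> = (C * suminf ?g) * (1 - z) powr (1/4)"
      using suminf_mult[OF sg, of "C * (1 - z) powr (1/4)"] by simp
    finally show "\<bar>suminf (\<lambda>m. z ^ Suc m * f m) - suminf f\<bar> \<le> (C * suminf ?g) * (1 - z) powr (1/4)" .
  qed
qed

text \<open>Only the series of \<open>hdefect\<close> needs an estimate, and Abel summation sends it
  to the same constant that enters \<open>hreg\<close>. The rest of the summand is
  \<open>hreg ys m / real (Suc m)\<close>, which by linearity sums exactly to the shifted
  \<open>hexp\<close>.\<close>

lemma Li_hexp_bound:
  assumes "small xs"
  shows "\<exists>K. \<forall>z. 0 \<le> z \<and> z < 1 \<longrightarrow> \<bar>Li xs z - hexp (\<lambda>j. Li (zeros j) z) xs\<bar> \<le> K * (1 - z) powr (1/4)"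
proof (cases xs)
  case Nil
  then show ?thesis by (auto intro: exI[of _ 0])
next
  case (Cons x ys)
  obtain D where "\<And>m. \<bar>hdefect x ys m\<bar> \<le> D / (real (Suc m) * sqrt (real (Suc m)))"
    using hdefect_bound[of x ys] assms Cons by auto
  from abelian_bound[of "hdefect x ys", OF this] obtain K where K:
    "\<And>z. 0 \<le> z \<and> z < 1 \<Longrightarrow> summable (\<lambda>m. z ^ Suc m * hdefect x ys m) \<and>
      \<bar>suminf (\<lambda>m. z ^ Suc m * hdefect x ys m) - suminf (hdefect x ys)\<bar> \<le> K * (1 - z) powr (1/4)" by blast
  have "\<bar>Li xs z - hexp (\<lambda>j. Li (zeros j) z) xs\<bar> \<le> K * (1 - z) powr (1/4)" if z: "0 \<le> z \<and> z < 1" for z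
  proof -
    have z1: "\<bar>z\<bar> < 1" using z by simp
    have "(\<lambda>m. (z ^ Suc m / real (Suc m)) * hexp (\<lambda>j. hsum (zeros j) m) ys) sums hexp (\<lambda>j. Li (zeros (Suc j)) z) ys"
    proof (rule hexp_sums)
      fix j
      show "(\<lambda>m. (z ^ Suc m / real (Suc m)) * hsum (zeros j) m) sums Li (zeros (Suc j)) z"
        using Li_sums[of 0 "zeros j" z] z1 small_zeros by simp
    qed
    then have "(\<lambda>m. z ^ Suc m * (hreg ys m / real (Suc m))) sums hexp (\<lambda>j. Li (zeros (Suc j)) z) ys"
      by (simp add: hreg_eq_hexp)
    from sums_add[OF summable_sums[OF conjunct1[OF K[OF z]]] this]
    have "(\<lambda>m. z ^ Suc m * (hsum ys m / (real (Suc m) - x))) sums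
       (suminf (\<lambda>m. z ^ Suc m * hdefect x ys m) + hexp (\<lambda>j. Li (zeros (Suc j)) z) ys)"
      by (simp add: hdefect_def algebra_simps)
    then have "Li xs z = suminf (\<lambda>m. z ^ Suc m * hdefect x ys m) + hexp (\<lambda>j. Li (zeros (Suc j)) z) ys"
      using Li_sums[of x ys z] assms z1 Cons sums_unique2 by blast
    then show ?thesis using K[OF z] Cons by simp
  qed
  then show ?thesis by blast
qed

text \<open>\<open>hexp U xs\<close> cuts \<open>xs\<close> into a prefix, entering through
  \<open>U\<close> at its length, and a suffix, entering through a constant. If letters of both
  kinds occur, some prefix letter is cyclically followed by a suffix letter; linking these two or
  not gives the same product with opposite signs. Only the terms with letters of a single kind
  survive.\<close>

lemma cyclic_alt_hexp:
  assumes "U 0 = 1"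
  shows "cyclic_alt (hexp U) a b c d =
    cyclic_alt (hexp (\<lambda>j. if j = 0 then 1 else 0)) a b c d + cyclic_alt (\<lambda>xs. U (length xs)) 0 0 0 0"
  unfolding cyclic_alt_def by (simp add: assms) algebra

text \<open>As a function of z, \<open>polylog (zeros j)\<close> is (- ln (1 - z))^j / j!, and this
  is the passage from j to j + 1.\<close>

lemma polylog_zeros_mult: "polylog [0] * polylog (zeros j) = of_nat (Suc j) * polylog (zeros (Suc j))"
proof (induction j)
  case (Suc j)
  have "polylog [0] * polylog (zeros (Suc j)) = shint (0 + 0) (polylog [] * polylog (zeros (Suc j)) + polylog [0] * polylog (zeros j))"
    unfolding replicate_Suc by (rule polylog_shuffle) simp
  also have "\<dots> = shint 0 (of_nat (Suc (Suc j)) * polylog (zeros (Suc j)))"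
    unfolding Suc.IH by (simp add: algebra_simps)
  also have "\<dots> = of_nat (Suc (Suc j)) * shint 0 (polylog (zeros (Suc j)))"
    by (simp add: fps_eq_iff shint_def fps_mult_of_nat_nth sum_distrib_left[symmetric] del: of_nat_Suc)
  finally show ?case by simp
qed simp

lemma Li_zeros_bound:
  assumes "\<bar>z\<bar> < 1"
  shows "\<bar>Li (zeros j) z\<bar> \<le> \<bar>Li [0] z\<bar> ^ j"
proof (induction j)
  case (Suc j)
  have of_nat: "fps_conv_radius (of_nat n :: real fps) \<ge> 1" "eval_fps (of_nat n :: real fps) z = of_nat n" for n
    by (simp_all flip: fps_of_nat)
  have "Li [0] z * Li (zeros j) z = eval_fps (polylog [0] * polylog (zeros j)) z"
    by (rule Li_mult[symmetric]) (use assms small_zeros in auto)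
  also have "\<dots> = real (Suc j) * Li (zeros (Suc j)) z"
    unfolding polylog_zeros_mult Li_def
      eval_fps_ring_ge_1(6)[OF of_nat(1) polylog_radius[OF small_zeros] assms] of_nat(2) ..
  finally have "real (Suc j) * \<bar>Li (zeros (Suc j)) z\<bar> = \<bar>Li [0] z\<bar> * \<bar>Li (zeros j) z\<bar>"
    by (metis abs_mult abs_of_nat)
  moreover have "\<bar>Li (zeros (Suc j)) z\<bar> \<le> real (Suc j) * \<bar>Li (zeros (Suc j)) z\<bar>"
    by (simp add: mult_le_cancel_right1)
  moreover have "\<bar>Li [0] z\<bar> * \<bar>Li (zeros j) z\<bar> \<le> \<bar>Li [0] z\<bar> * \<bar>Li [0] z\<bar> ^ j"
    by (intro mult_left_mono Suc.IH) auto
  ultimately show ?case by simp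
qed simp

lemma Li_0:
  assumes "\<bar>z\<bar> < 1"
  shows "Li [0] z = - ln (1 - z)"
proof -
  have "(\<lambda>n. - ((- (- z)) ^ n) / of_nat n) sums ln (1 + (- z))"
    by (rule ln_series') (use assms in auto)
  then have "(\<lambda>n. z ^ n / real n) sums (- ln (1 - z))"
    using sums_minus by fastforce
  then have "(\<lambda>n. z ^ Suc n / real (Suc n)) sums (- ln (1 - z))"
    by (subst sums_Suc_iff) simp
  moreover have "(\<lambda>n. z ^ Suc n / real (Suc n)) sums Li [0] z"
    using Li_sums[of 0 "[]" z] assms by simp
  ultimately show ?thesis using sums_unique2 by blast
qed

lemma sum_inverse_le_ln: "(\<Sum>m<n. 1 / real (Suc m)) \<le> 1 + ln (real (Suc n))"
proof -
  have "(\<Sum>m<Suc n. 1 / real (Suc m)) \<le> 1 + ln (real (Suc n))" for n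
  proof (induction n)
    case (Suc n)
    have "ln (real (Suc n) / real (Suc (Suc n))) \<le> real (Suc n) / real (Suc (Suc n)) - 1"
      by (rule ln_le_minus_one) simp
    then have "1 / real (Suc (Suc n)) \<le> ln (real (Suc (Suc n))) - ln (real (Suc n))"
      by (subst (asm) ln_div) (auto simp: field_simps)
    then show ?case using Suc by simp
  qed simp
  then have "(\<Sum>m<Suc n. 1 / real (Suc m)) \<le> 1 + ln (real (Suc n))" .
  moreover have "(\<Sum>m<n. 1 / real (Suc m)) \<le> (\<Sum>m<Suc n. 1 / real (Suc m))" by simp
  ultimately show ?thesis by linarith
qed

lemma hsum_zeros_bound: "\<bar>hsum (zeros j) n\<bar> \<le> (1 + ln (real (Suc n))) ^ j"
proof (induction j arbitrary: n)
  case (Suc j)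
  have ln: "0 \<le> 1 + ln (real (Suc m))" for m by (simp add: add_increasing)
  have "\<bar>hsum (zeros (Suc j)) n\<bar> \<le> (\<Sum>m<n. \<bar>hsum (zeros j) m / real (Suc m)\<bar>)"
    using sum_abs[of "\<lambda>m. hsum (zeros j) m / real (Suc m)" "{..<n}"] by simp
  also have "\<dots> \<le> (\<Sum>m<n. (1 + ln (real (Suc n))) ^ j * (1 / real (Suc m)))"
  proof (rule sum_mono)
    fix m assume "m \<in> {..<n}"
    then have "(1 + ln (real (Suc m))) ^ j \<le> (1 + ln (real (Suc n))) ^ j"
      by (intro power_mono ln) auto
    then have "\<bar>hsum (zeros j) m\<bar> \<le> (1 + ln (real (Suc n))) ^ j" using Suc.IH[of m] by linarith
    then show "\<bar>hsum (zeros j) m / real (Suc m)\<bar> \<le> (1 + ln (real (Suc n))) ^ j * (1 / real (Suc m))"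
      by (simp add: abs_divide divide_right_mono del: of_nat_Suc)
  qed
  also have "\<dots> \<le> (1 + ln (real (Suc n))) ^ j * (1 + ln (real (Suc n)))"
    unfolding sum_distrib_left[symmetric] by (intro mult_left_mono sum_inverse_le_ln zero_le_power ln)
  finally show ?case by (simp add: mult.commute)
qed simp

section \<open>Errors negligible against every power of a logarithm\<close>

locale log_scale =
  fixes F :: "'t filter" and \<Lambda> :: "'t \<Rightarrow> real"
  assumes scale_ge_1: "eventually (\<lambda>t. 1 \<le> \<Lambda> t) F"
begin

text \<open>Negligible functions absorb multiplication by moderate ones, so a polynomial expression
  such as \<open>cyclic_alt\<close> does not see negligible changes of moderate arguments. The scale
  is abstract because it serves twice: for n tending to infinity and for z tending to 1 from
  below.\<close>

definition negl :: "('t \<Rightarrow> real) \<Rightarrow> bool" where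
  "negl f \<longleftrightarrow> (\<forall>k. ((\<lambda>t. \<Lambda> t ^ k * f t) \<longlongrightarrow> 0) F)"

definition moderate :: "('t \<Rightarrow> real) \<Rightarrow> bool" where
  "moderate f \<longleftrightarrow> (\<exists>C k. eventually (\<lambda>t. \<bar>f t\<bar> \<le> C * \<Lambda> t ^ k) F)"

definition close :: "('t \<Rightarrow> real) \<Rightarrow> ('t \<Rightarrow> real) \<Rightarrow> bool" where
  "close f g \<longleftrightarrow> negl (\<lambda>t. f t - g t) \<and> moderate g"

lemma moderateI: "eventually (\<lambda>t. \<bar>f t\<bar> \<le> C * \<Lambda> t ^ k) F \<Longrightarrow> moderate f"
  unfolding moderate_def by blast

lemma moderateE:
  assumes "moderate f"
  obtains C k where "C \<ge> 0" "\<And>m. m \<ge> k \<Longrightarrow> eventually (\<lambda>t. \<bar>f t\<bar> \<le> C * \<Lambda> t ^ m) F"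
proof -
  obtain C k where Ck: "eventually (\<lambda>t. \<bar>f t\<bar> \<le> C * \<Lambda> t ^ k) F" using assms by (auto simp: moderate_def)
  have "eventually (\<lambda>t. \<bar>f t\<bar> \<le> \<bar>C\<bar> * \<Lambda> t ^ m) F" if "m \<ge> k" for m
    using Ck scale_ge_1
  proof eventually_elim
    case (elim t)
    have "C * \<Lambda> t ^ k \<le> \<bar>C\<bar> * \<Lambda> t ^ m"
      by (intro mult_mono power_increasing that) (use elim in auto)
    then show ?case using elim by linarith
  qed
  then show ?thesis using that[of "\<bar>C\<bar>" k] by auto
qed

lemma moderate_add: assumes "moderate f" "moderate g" shows "moderate (\<lambda>t. f t + g t)"
proof -
  obtain C k where C: "C \<ge> 0" "\<And>m. m \<ge> k \<Longrightarrow> eventually (\<lambda>t. \<bar>f t\<bar> \<le> C * \<Lambda> t ^ m) F" using moderateE[OF assms(1)] by blast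
  obtain D l where D: "D \<ge> 0" "\<And>m. m \<ge> l \<Longrightarrow> eventually (\<lambda>t. \<bar>g t\<bar> \<le> D * \<Lambda> t ^ m) F" using moderateE[OF assms(2)] by blast
  have "eventually (\<lambda>t. \<bar>f t + g t\<bar> \<le> (C + D) * \<Lambda> t ^ (k + l)) F"
    using C(2)[of "k + l", OF le_add1] D(2)[of "k + l", OF le_add2]
  proof eventually_elim
    case (elim t)
    then show ?case unfolding distrib_right by linarith
  qed
  then show ?thesis by (rule moderateI)
qed

lemma moderate_mult: assumes "moderate f" "moderate g" shows "moderate (\<lambda>t. f t * g t)"
proof -
  obtain C k where C: "C \<ge> 0" "\<And>m. m \<ge> k \<Longrightarrow> eventually (\<lambda>t. \<bar>f t\<bar> \<le> C * \<Lambda> t ^ m) F" using moderateE[OF assms(1)] by blast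
  obtain D l where D: "D \<ge> 0" "\<And>m. m \<ge> l \<Longrightarrow> eventually (\<lambda>t. \<bar>g t\<bar> \<le> D * \<Lambda> t ^ m) F" using moderateE[OF assms(2)] by blast
  have "eventually (\<lambda>t. \<bar>f t * g t\<bar> \<le> (C * D) * \<Lambda> t ^ (k + l)) F"
    using C(2)[OF order_refl] D(2)[OF order_refl] scale_ge_1
  proof eventually_elim
    case (elim t)
    have "\<bar>f t\<bar> * \<bar>g t\<bar> \<le> (C * \<Lambda> t ^ k) * (D * \<Lambda> t ^ l)"
      by (rule mult_mono) (use elim C D in auto)
    then show ?case by (simp add: abs_mult power_add mult_ac)
  qed
  then show ?thesis by (rule moderateI)
qed

lemma moderate_const: "moderate (\<lambda>t. c)"
  by (rule moderateI[of _ "\<bar>c\<bar>" 0]) simp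

lemma moderate_uminus: "moderate f \<Longrightarrow> moderate (\<lambda>t. - f t)"
  by (simp add: moderate_def)

lemma negl_add: "negl f \<Longrightarrow> negl g \<Longrightarrow> negl (\<lambda>t. f t + g t)"
  unfolding negl_def distrib_left using tendsto_add_zero by blast

lemma negl_uminus: "negl f \<Longrightarrow> negl (\<lambda>t. - f t)"
  unfolding negl_def using tendsto_minus by fastforce

lemma negl_mult_negl: assumes "negl f" "negl g" shows "negl (\<lambda>t. f t * g t)"
proof -
  have "((\<lambda>t. (\<Lambda> t ^ k * f t) * (\<Lambda> t ^ 0 * g t)) \<longlongrightarrow> 0 * 0) F" for k
    using assms unfolding negl_def by (intro tendsto_mult) blast+
  then show ?thesis by (simp add: negl_def mult.assoc)
qed

lemma negl_mult: assumes "negl f" "moderate g" shows "negl (\<lambda>t. f t * g t)"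
  unfolding negl_def
proof
  fix k
  obtain C l where C: "C \<ge> 0" "\<And>m. m \<ge> l \<Longrightarrow> eventually (\<lambda>t. \<bar>g t\<bar> \<le> C * \<Lambda> t ^ m) F" using moderateE[OF assms(2)] by blast
  have "((\<lambda>t. \<Lambda> t ^ (k + l) * f t) \<longlongrightarrow> 0) F" using assms(1) by (simp add: negl_def)
  moreover have "eventually (\<lambda>t. norm (\<Lambda> t ^ k * (f t * g t)) \<le> norm (\<Lambda> t ^ (k + l) * f t) * C) F"
    using C(2)[OF order_refl] scale_ge_1
  proof eventually_elim
    case (elim t)
    have "\<bar>\<Lambda> t ^ k * f t\<bar> * \<bar>g t\<bar> \<le> \<bar>\<Lambda> t ^ k * f t\<bar> * (C * \<Lambda> t ^ l)"
      by (intro mult_left_mono elim) auto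
    then show ?case using elim by (simp add: abs_mult power_add mult_ac)
  qed
  ultimately show "((\<lambda>t. \<Lambda> t ^ k * (f t * g t)) \<longlongrightarrow> 0) F"
    by (rule tendsto_0_le)
qed

lemma close_add: "close f g \<Longrightarrow> close f' g' \<Longrightarrow> close (\<lambda>t. f t + f' t) (\<lambda>t. g t + g' t)"
  using negl_add[of "\<lambda>t. f t - g t" "\<lambda>t. f' t - g' t"] moderate_add[of g g']
  by (auto simp: close_def algebra_simps)

lemma close_diff: "close f g \<Longrightarrow> close f' g' \<Longrightarrow> close (\<lambda>t. f t - f' t) (\<lambda>t. g t - g' t)"
  using negl_add[OF _ negl_uminus, of "\<lambda>t. f t - g t" "\<lambda>t. f' t - g' t"] moderate_add[OF _ moderate_uminus, of g g']
  by (auto simp: close_def algebra_simps)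

lemma close_mult:
  assumes "close f g" "close f' g'"
  shows "close (\<lambda>t. f t * f' t) (\<lambda>t. g t * g' t)"
proof -
  \<comment> \<open>Expanding around g and g' requires moderate growth of these two only, which is
    what \<open>close\<close> provides.\<close>
  have "negl (\<lambda>t. (f t - g t) * (f' t - g' t) + (f t - g t) * g' t + (f' t - g' t) * g t)"
    using assms unfolding close_def by (intro negl_add negl_mult negl_mult_negl) auto
  then show ?thesis using assms moderate_mult by (auto simp: close_def algebra_simps)
qed

lemma close_cyclic_alt:
  assumes "\<And>xs. set xs \<subseteq> {a, b, c, d} \<Longrightarrow> close (\<lambda>t. M t xs) (\<lambda>t. N t xs)"
  shows "close (\<lambda>t. cyclic_alt (M t) a b c d) (\<lambda>t. cyclic_alt (N t) a b c d)"
  unfolding cyclic_alt_def by (intro close_add close_diff close_mult assms) auto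

lemma moderate_hexp:
  assumes "\<And>j. moderate (\<lambda>t. U t j)"
  shows "moderate (\<lambda>t. hexp (U t) xs)"
  using assms by (induction xs arbitrary: U) (auto intro!: moderate_add moderate_mult moderate_const)

lemma close_tendsto:
  assumes "close f g" shows "((\<lambda>t. f t - g t) \<longlongrightarrow> 0) F"
  using assms unfolding close_def negl_def by (metis (no_types, lifting) ext mult_1 power_0)

text \<open>The limit involves only the constants \<open>suminf (hdefect x xs)\<close>, neither
  \<open>U\<close> nor the scale, so both regularisations lead to the same number. The zeros in the
  subtracted term are placeholders, since only lengths enter there.\<close>

lemma cyclic_alt_limit:
  assumes "\<And>xs. set xs \<subseteq> {a, b, c, d} \<Longrightarrow> negl (\<lambda>t. M t xs - hexp (U t) xs)"
    and "\<And>j. eventually (\<lambda>t. \<bar>U t j\<bar> \<le> \<Lambda> t ^ j) F" "\<And>t. U t 0 = 1"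
  shows "((\<lambda>t. cyclic_alt (M t) a b c d - cyclic_alt (\<lambda>xs. U t (length xs)) 0 0 0 0)
    \<longlongrightarrow> cyclic_alt (hexp (\<lambda>j. if j = 0 then 1 else 0)) a b c d) F"
proof -
  have "moderate (\<lambda>t. U t j)" for j
    by (rule moderateI[of _ 1 j]) (use assms(2) in simp)
  then have "close (\<lambda>t. M t xs) (\<lambda>t. hexp (U t) xs)" if "set xs \<subseteq> {a, b, c, d}" for xs
    using assms(1)[OF that] moderate_hexp by (auto simp: close_def)
  from close_tendsto[OF close_cyclic_alt[OF this]]
  have "((\<lambda>t. cyclic_alt (M t) a b c d - cyclic_alt (hexp (U t)) a b c d) \<longlongrightarrow> 0) F" by simp
  from tendsto_add[OF this tendsto_const[of "cyclic_alt (hexp (\<lambda>j. if j = 0 then 1 else 0)) a b c d"]]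
  show ?thesis unfolding cyclic_alt_hexp[where U = "U t" for t, OF assms(3)] by (simp add: algebra_simps)
qed

end

lemma tendsto_altsum:
  fixes f :: "'t \<Rightarrow> real \<Rightarrow> real \<Rightarrow> real \<Rightarrow> real \<Rightarrow> real"
  assumes "\<bar>a\<bar> \<le> 1/8" "\<bar>b\<bar> \<le> 1/8" "\<bar>c\<bar> \<le> 1/8" "\<bar>d\<bar> \<le> 1/8"
    and "\<And>p q r s. small [p, q, r, s] \<Longrightarrow> ((\<lambda>t. f t p q r s) \<longlongrightarrow> g p q r s) F"
  shows "((\<lambda>t. altsum (f t) a b c d) \<longlongrightarrow> altsum g a b c d) F"
proof -
  have "((\<lambda>t. \<Sum>(e, p, q, r, s)\<leftarrow>ws. of_int e * f t p q r s) \<longlongrightarrow> (\<Sum>(e, p, q, r, s)\<leftarrow>ws. of_int e * g p q r s)) F"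
    if "\<forall>(e, p, q, r, s)\<in>set ws. small [p, q, r, s]" for ws
    using that
  proof (induction ws)
    case (Cons w ws)
    obtain e p q r s where w: "w = (e, p, q, r, s)" by (cases w)
    show ?case using Cons unfolding w by (auto intro!: tendsto_add tendsto_mult assms(5))
  qed simp
  then show ?thesis
    unfolding altsum_def using altwords_small[OF assms(1-4)] by blast
qed

lemma altsum_diff:
  "altsum (\<lambda>p q r s. f p q r s - g p q r s) a b c d = altsum f a b c d - (altsum g a b c d :: real)"
proof -
  have "(\<Sum>(e, p, q, r, s)\<leftarrow>ws. of_int e * (f p q r s - g p q r s)) =
     (\<Sum>(e, p, q, r, s)\<leftarrow>ws. of_int e * f p q r s) - (\<Sum>(e, p, q, r, s)\<leftarrow>ws. of_int e * g p q r s)" for ws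
    by (induction ws) (auto simp: algebra_simps)
  then show ?thesis unfolding altsum_def .
qed

section \<open>Generating function of the convergent multiple zeta values\<close>

lemma hdefect_summable:
  assumes "small (x # xs)"
  shows "summable (hdefect x xs)"
  using hdefect_bound[OF assms] summable_pow32_bound(1) summable_rabs_cancel by blast

text \<open>Since 1 / (m - p) - 1 / m = p / m^2 + p^2 / m^3 + ..., this generates the values
  \<open>mzv\<close> with first argument at least 2; the subtraction removes exactly the divergent
  ones.\<close>

definition mzv_gf :: "real \<Rightarrow> real \<Rightarrow> real \<Rightarrow> real \<Rightarrow> real" where
  "mzv_gf p q r s = suminf (\<lambda>m. (1 / (real (Suc m) - p) - 1 / real (Suc m)) * hsum [q, r, s] m)"

lemma mzv_gf_eq:
  assumes "small [p, q, r, s]"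
  shows "mzv_gf p q r s = suminf (hdefect p [q, r, s]) - suminf (hdefect 0 [q, r, s])"
proof -
  have "suminf (hdefect p [q, r, s]) - suminf (hdefect 0 [q, r, s])
      = suminf (\<lambda>m. hdefect p [q, r, s] m - hdefect 0 [q, r, s] m)"
    by (rule suminf_diff) (use assms hdefect_summable in auto)
  then show ?thesis
    by (simp add: hdefect_def mzv_gf_def left_diff_distrib del: of_nat_Suc hsum.simps)
qed

interpretation nat_scale: log_scale sequentially "\<lambda>n. 1 + ln (real (Suc n))"
  by unfold_locales simp

lemma nat_scale_negl:
  assumes "\<And>n. \<bar>f n\<bar> \<le> C / sqrt (real (Suc n))"
  shows "nat_scale.negl f"
  unfolding nat_scale.negl_def
proof
  fix k
  have "(\<lambda>n. (1 + ln (real (Suc n))) ^ k * (C / sqrt (real (Suc n)))) \<longlonglongrightarrow> 0"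
    by real_asymp
  moreover have "norm ((1 + ln (real (Suc n))) ^ k * f n) \<le> norm ((1 + ln (real (Suc n))) ^ k * (C / sqrt (real (Suc n))))" for n
  proof -
    have "\<bar>f n\<bar> \<le> \<bar>C / sqrt (real (Suc n))\<bar>" using assms[of n] by linarith
    then show ?thesis unfolding real_norm_def abs_mult[of "_ ^ _"] by (intro mult_left_mono) auto
  qed
  ultimately show "(\<lambda>n. (1 + ln (real (Suc n))) ^ k * f n) \<longlonglongrightarrow> 0"
    by (rule Lim_null_comparison[rotated, OF tendsto_norm_zero always_eventually[OF allI]])
qed

lemma log_scale_at_left: "log_scale (at_left 1) (\<lambda>z. 1 - ln (1 - z))"
proof
  have "eventually (\<lambda>z::real. z \<in> {0<..<1}) (at_left 1)"
    by (rule eventually_at_left_real) simp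
  then show "eventually (\<lambda>z::real. 1 \<le> 1 - ln (1 - z)) (at_left 1)"
    by eventually_elim auto
qed

interpretation left_scale: log_scale "at_left 1" "\<lambda>z. 1 - ln (1 - z)"
  by (rule log_scale_at_left)

lemma eventually_unit_interval: "eventually (\<lambda>z::real. 0 < z \<and> z < 1) (at_left 1)"
  using eventually_at_left_real[of 0 1] by simp

lemma left_scale_negl:
  assumes "\<And>z. 0 \<le> z \<and> z < 1 \<Longrightarrow> \<bar>f z\<bar> \<le> C * (1 - z) powr (1/4)"
  shows "left_scale.negl f"
  unfolding left_scale.negl_def
proof
  fix k
  have "((\<lambda>z. (1 - ln (1 - z)) ^ k * (C * (1 - z) powr (1/4))) \<longlongrightarrow> 0) (at_left 1)"
    by real_asymp
  moreover have "eventually (\<lambda>z. norm ((1 - ln (1 - z)) ^ k * f z) \<le> norm ((1 - ln (1 - z)) ^ k * (C * (1 - z) powr (1/4)))) (at_left 1)"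
    using eventually_unit_interval
  proof eventually_elim
    case (elim z)
    then have "\<bar>f z\<bar> \<le> \<bar>C * (1 - z) powr (1/4)\<bar>" using assms[of z] by (auto intro: order_trans[OF _ abs_ge_self])
    then show ?case unfolding real_norm_def abs_mult[of "_ ^ _"] by (intro mult_left_mono) auto
  qed
  ultimately show "((\<lambda>z. (1 - ln (1 - z)) ^ k * f z) \<longlongrightarrow> 0) (at_left 1)"
    by (rule Lim_null_comparison[rotated, OF tendsto_norm_zero])
qed

text \<open>The additive constant zeta(4) measures how the regularisations differ at parameters 0:
  truncation gives the sum of 1 / m^4 there, the power series give 0. In the limit, each exceeds its
  own value at 0 by the same \<open>Q\<close>.\<close>

theorem altsum_mzv_gf:
  assumes "\<bar>a\<bar> \<le> 1/8" "\<bar>b\<bar> \<le> 1/8" "\<bar>c\<bar> \<le> 1/8" "\<bar>d\<bar> \<le> 1/8"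
  shows "(\<lambda>m. 1 / ((real (Suc m) - a) * (real (Suc m) - b) * (real (Suc m) - c) * (real (Suc m) - d)))
    sums (altsum mzv_gf a b c d + suminf (\<lambda>m. 1 / real (Suc m) ^ 4))"
proof -
  define Q where "Q = cyclic_alt (hexp (\<lambda>j. if j = 0 then 1 else 0)) a b c d"
  have sm: "small xs" if "set xs \<subseteq> {a, b, c, d}" for xs
  proof -
    have "\<bar>x\<bar> \<le> 1/2" if "x \<in> {a, b, c, d}" for x using that assms by auto
    then show ?thesis using that by (auto simp: small_def)
  qed
  have "(\<lambda>n. cyclic_alt (\<lambda>xs. hsum xs n) a b c d - cyclic_alt (\<lambda>xs. hsum (zeros (length xs)) n) 0 0 0 0)
    \<longlonglongrightarrow> Q"
    unfolding Q_def
  proof (rule nat_scale.cyclic_alt_limit)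
    fix xs assume "set xs \<subseteq> {a, b, c, d}"
    from hsum_hreg_bound[OF sm[OF this], unfolded hreg_eq_hexp] obtain C
      where "\<And>n. \<bar>hsum xs n - hexp (\<lambda>j. hsum (zeros j) n) xs\<bar> \<le> C / sqrt (real (Suc n))" by auto
    then show "nat_scale.negl (\<lambda>n. hsum xs n - hexp (\<lambda>j. hsum (zeros j) n) xs)"
      by (rule nat_scale_negl)
  qed (use hsum_zeros_bound in auto)
  moreover have "cyclic_alt (\<lambda>xs. hsum (zeros (length xs)) n) 0 0 0 0 = (\<Sum>m<n. 1 / real (Suc m) ^ 4)" for n
  proof -
    have "cyclic_alt (\<lambda>xs. hsum (zeros (length xs)) n) 0 0 0 0 = cyclic_alt (\<lambda>xs. hsum xs n) 0 0 0 0"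
      unfolding cyclic_alt_def by (simp del: hsum.simps)
    also have "\<dots> = (\<Sum>m<n. 1 / real (Suc m) ^ 4)"
      unfolding cyclic_alt_hsum by (simp add: power4_eq_xxxx mult_ac)
    finally show ?thesis .
  qed
  ultimately have lim1: "(\<lambda>n. cyclic_alt (\<lambda>xs. hsum xs n) a b c d - (\<Sum>m<n. 1 / real (Suc m) ^ 4)) \<longlonglongrightarrow> Q"
    by simp
  have "summable (\<lambda>m. 1 / real (Suc m) ^ 4)"
    using inverse_power_summable[of 4, where ?'a = real] by (subst summable_Suc_iff) (simp add: inverse_eq_divide)
  then have "(\<lambda>n. \<Sum>m<n. 1 / real (Suc m) ^ 4) \<longlonglongrightarrow> suminf (\<lambda>m. 1 / real (Suc m) ^ 4)"
    by (rule summable_LIMSEQ)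
  from tendsto_add[OF lim1 this] have E: "(\<lambda>m. 1 / ((real (Suc m) - a) * (real (Suc m) - b) * (real (Suc m) - c) * (real (Suc m) - d)))
    sums (Q + suminf (\<lambda>m. 1 / real (Suc m) ^ 4))"
    unfolding sums_def cyclic_alt_hsum diff_add_cancel .

  have negl: "left_scale.negl (\<lambda>z. Li xs z - hexp (\<lambda>j. Li (zeros j) z) xs)" if "small xs" for xs
  proof -
    from Li_hexp_bound[OF that] obtain K where
      "\<And>z. 0 \<le> z \<and> z < 1 \<Longrightarrow> \<bar>Li xs z - hexp (\<lambda>j. Li (zeros j) z) xs\<bar> \<le> K * (1 - z) powr (1/4)" by auto
    then show ?thesis by (rule left_scale_negl)
  qed
  have lim2: "((\<lambda>z. cyclic_alt (\<lambda>xs. Li xs z) a b c d - cyclic_alt (\<lambda>xs. Li (zeros (length xs)) z) 0 0 0 0)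
    \<longlongrightarrow> Q) (at_left 1)"
    unfolding Q_def
  proof (rule left_scale.cyclic_alt_limit)
    show "eventually (\<lambda>z. \<bar>Li (zeros j) z\<bar> \<le> (1 - ln (1 - z)) ^ j) (at_left 1)" for j
      using eventually_unit_interval
    proof eventually_elim
      case (elim z)
      then have "\<bar>Li (zeros j) z\<bar> \<le> \<bar>Li [0] z\<bar> ^ j" by (intro Li_zeros_bound) auto
      also have "\<dots> \<le> (1 - ln (1 - z)) ^ j"
        by (intro power_mono) (use elim Li_0[of z] in auto)
      finally show ?case .
    qed
  qed (use negl sm in auto)
  \<comment> \<open>The single words may diverge as z tends to 1. Subtracting
    \<open>Li [0, q, r, s] z\<close> costs nothing by \<open>altsum_const_first\<close> and makes
    every word converge.\<close>
  have eq: "eventually (\<lambda>z. cyclic_alt (\<lambda>xs. Li xs z) a b c d - cyclic_alt (\<lambda>xs. Li (zeros (length xs)) z) 0 0 0 0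
    = altsum (\<lambda>p q r s. Li [p, q, r, s] z - Li [0, q, r, s] z) a b c d) (at_left 1)"
    using eventually_unit_interval
  proof eventually_elim
    case (elim z)
    then have z: "\<bar>z\<bar> < 1" by simp
    have cyc: "cyclic_alt (\<lambda>xs. Li xs z) a b c d = altsum (\<lambda>p q r s. Li [p, q, r, s] z) a b c d"
      if "\<bar>a\<bar> \<le> 1/8" "\<bar>b\<bar> \<le> 1/8" "\<bar>c\<bar> \<le> 1/8" "\<bar>d\<bar> \<le> 1/8" for a b c d
      using eval_fps_cyclic_alt[of a b c d z] eval_fps_altsum[OF that z] that z
      by (simp add: cyclic_alt_polylog[OF that] del: polylog_simps)
    have "cyclic_alt (\<lambda>xs. Li (zeros (length xs)) z) 0 0 0 0 = cyclic_alt (\<lambda>xs. Li xs z) 0 0 0 0"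
      unfolding cyclic_alt_def by simp
    also have "\<dots> = altsum (\<lambda>p q r s. Li [0, 0, 0, 0] z) 0 0 0 0"
      unfolding cyc[of 0 0 0 0, simplified] altsum_def
      by (simp add: altwords_def words1111_def words211_def words31_def words22_def)
    also have "\<dots> = 0" by (rule altsum_const_first)
    finally show ?case
      unfolding altsum_diff altsum_const_first[of "\<lambda>q r s. Li [0, q, r, s] z"] using cyc[OF assms] by simp
  qed
  have "((\<lambda>z. altsum (\<lambda>p q r s. Li [p, q, r, s] z - Li [0, q, r, s] z) a b c d) \<longlongrightarrow> altsum mzv_gf a b c d) (at_left 1)"
  proof (rule tendsto_altsum[OF assms])
    fix p q r s assume s: "small [p, q, r, s]"
    then have s0: "small [0, q, r, s]" by simp
    have "left_scale.negl (\<lambda>z. (Li [p, q, r, s] z - hexp (\<lambda>j. Li (zeros j) z) [p, q, r, s])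
        + - (Li [0, q, r, s] z - hexp (\<lambda>j. Li (zeros j) z) [0, q, r, s]))"
      by (intro left_scale.negl_add left_scale.negl_uminus negl s s0)
    then have "((\<lambda>z. (Li [p, q, r, s] z - hexp (\<lambda>j. Li (zeros j) z) [p, q, r, s])
        + - (Li [0, q, r, s] z - hexp (\<lambda>j. Li (zeros j) z) [0, q, r, s])) \<longlongrightarrow> 0) (at_left 1)"
      unfolding left_scale.negl_def by (metis (no_types, lifting) ext mult_1 power_0)
    \<comment> \<open>The expansions for p and for 0 share all terms containing a logarithm; they
      differ only in the leading constant, and that difference is \<open>mzv_gf\<close>.\<close>
    then have "((\<lambda>z. Li [p, q, r, s] z - Li [0, q, r, s] z - mzv_gf p q r s) \<longlongrightarrow> 0) (at_left 1)"
      unfolding mzv_gf_eq[OF s] by (simp add: algebra_simps)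
    then show "((\<lambda>z. Li [p, q, r, s] z - Li [0, q, r, s] z) \<longlongrightarrow> mzv_gf p q r s) (at_left 1)"
      by (simp add: LIM_zero_iff)
  qed
  moreover have "((\<lambda>z. altsum (\<lambda>p q r s. Li [p, q, r, s] z - Li [0, q, r, s] z) a b c d) \<longlongrightarrow> Q) (at_left 1)"
    using lim2 eq by (rule Lim_transform_eventually)
  ultimately have "altsum mzv_gf a b c d = Q"
    by (rule tendsto_unique[OF trivial_limit_at_left_real])
  then show ?thesis using E by simp
qed

section \<open>Expansion of the generating functions\<close>

lemma has_sum_times:
  fixes f :: "'a \<Rightarrow> real" and g :: "'b \<Rightarrow> real"
  assumes "(f has_sum S) A" "(g has_sum T) B"
    and "(\<lambda>x. \<bar>f x\<bar>) summable_on A" "(\<lambda>y. \<bar>g y\<bar>) summable_on B"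
  shows "((\<lambda>(x, y). f x * g y) has_sum S * T) (A \<times> B)"
    and "(\<lambda>z. \<bar>case z of (x, y) \<Rightarrow> f x * g y\<bar>) summable_on A \<times> B"
proof -
  have *: "(\<lambda>z. norm (case z of (x, y) \<Rightarrow> f x * g y)) summable_on A \<times> B"
    unfolding abs_summable_on_Sigma_iff
    using assms(3,4) by (auto simp: abs_mult infsum_cmult_right' intro!: summable_on_cmult_right summable_on_cmult_left)
  then show "(\<lambda>z. \<bar>case z of (x, y) \<Rightarrow> f x * g y\<bar>) summable_on A \<times> B"
    by simp
  show "((\<lambda>(x, y). f x * g y) has_sum S * T) (A \<times> B)"
  proof (rule has_sum_SigmaI)
    show "((\<lambda>y. case (x, y) of (x, y) \<Rightarrow> f x * g y) has_sum f x * T) B" for x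
      using has_sum_cmult_right[OF assms(2)] by simp
    show "((\<lambda>x. f x * T) has_sum S * T) A"
      by (rule has_sum_cmult_left[OF assms(1)])
    show "(\<lambda>(x, y). f x * g y) summable_on A \<times> B"
      by (rule abs_summable_summable[OF *])
  qed
qed

lemma geometric_has_sum:
  fixes m y :: real
  assumes "m \<ge> 1" "\<bar>y\<bar> \<le> 1/2"
  shows "((\<lambda>k. y ^ k / m ^ Suc k) has_sum ((y / m) ^ e / (m - y))) {e..}"
    and "(\<lambda>k. \<bar>y ^ k / m ^ Suc k\<bar>) summable_on {e..}"
proof -
  have main: "((\<lambda>k. y ^ k / m ^ Suc k) has_sum ((y / m) ^ e / (m - y))) {e..}" if y: "\<bar>y\<bar> \<le> 1/2" for y
  proof -
    have r: "norm (y / m) < 1" using assms(1) y by (simp add: divide_simps)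
    have "(\<lambda>k. (y / m) ^ e / m * (y / m) ^ k) sums ((y / m) ^ e / m * (1 / (1 - y / m)))"
      by (intro sums_mult geometric_sums r)
    moreover have "1 - y / m = (m - y) / m" using assms(1) by (simp add: diff_divide_distrib)
    then have "(y / m) ^ e / m * (1 / (1 - y / m)) = (y / m) ^ e / (m - y)"
      using assms(1) by simp
    moreover have "(\<lambda>k. (y / m) ^ e / m * (y / m) ^ k) = (\<lambda>k. y ^ (k + e) / m ^ Suc (k + e))"
      by (simp add: fun_eq_iff power_add power_divide mult_ac)
    ultimately have s: "(\<lambda>k. y ^ (k + e) / m ^ Suc (k + e)) sums ((y / m) ^ e / (m - y))"
      by (simp only:)
    have "summable (\<lambda>k. \<bar>(y / m) ^ e / m\<bar> * norm (y / m) ^ k)"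
      by (intro summable_mult summable_geometric) (use r in auto)
    then have "summable (\<lambda>k. norm (y ^ (k + e) / m ^ Suc (k + e)))"
      by (simp add: power_add power_divide abs_mult power_abs mult_ac)
    then have "((\<lambda>k. y ^ (k + e) / m ^ Suc (k + e)) has_sum ((y / m) ^ e / (m - y))) UNIV"
      by (rule norm_summable_imp_has_sum[OF _ s])
    then show ?thesis
      by (subst (asm) has_sum_reindex_bij_witness[of UNIV "\<lambda>k. k - e" "\<lambda>k. k + e" "{e..}" "\<lambda>k. y ^ k / m ^ Suc k"]) auto
  qed
  show "((\<lambda>k. y ^ k / m ^ Suc k) has_sum ((y / m) ^ e / (m - y))) {e..}" by (rule main[OF assms(2)])
  have "\<bar>y ^ k / m ^ Suc k\<bar> = \<bar>y\<bar> ^ k / m ^ Suc k" for k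
    using assms(1) by (simp add: abs_mult power_abs)
  then show "(\<lambda>k. \<bar>y ^ k / m ^ Suc k\<bar>) summable_on {e..}"
    using main[of "\<bar>y\<bar>"] assms(2) has_sum_imp_summable by (simp only: abs_abs) blast
qed

definition quads :: "nat \<Rightarrow> (nat \<times> nat \<times> nat \<times> nat) set" where
  "quads e = {e..} \<times> UNIV \<times> UNIV \<times> UNIV"

text \<open>Both sides of the identity are expansions of this kind, over decreasing quadruples and
  over the diagonal. The number \<open>e\<close> is the least exponent of the first parameter: 1 for
  the former, 0 for the latter.\<close>

locale quad_family =
  fixes A :: "'a set" and m1 m2 m3 m4 :: "'a \<Rightarrow> real" and e :: nat
  assumes ge1: "\<And>a. a \<in> A \<Longrightarrow> m1 a \<ge> 1 \<and> m2 a \<ge> 1 \<and> m3 a \<ge> 1 \<and> m4 a \<ge> 1"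
    and sm: "(\<lambda>a. 1 / (m1 a ^ Suc e * m2 a * m3 a * m4 a)) summable_on A"
begin

definition weight :: "nat \<times> nat \<times> nat \<times> nat \<Rightarrow> real" where
  "weight = (\<lambda>(k1, k2, k3, k4). infsum (\<lambda>a. 1 / (m1 a ^ Suc k1 * m2 a ^ Suc k2 * m3 a ^ Suc k3 * m4 a ^ Suc k4)) A)"

definition kernel :: "real \<Rightarrow> real \<Rightarrow> real \<Rightarrow> real \<Rightarrow> 'a \<Rightarrow> real" where
  "kernel p q r s a = (p / m1 a) ^ e / ((m1 a - p) * (m2 a - q) * (m3 a - r) * (m4 a - s))"

lemma kernel_summable:
  assumes "\<bar>p\<bar> \<le> 1/2" "\<bar>q\<bar> \<le> 1/2" "\<bar>r\<bar> \<le> 1/2" "\<bar>s\<bar> \<le> 1/2"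
  shows "(\<lambda>a. \<bar>kernel p q r s a\<bar>) summable_on A"
proof (rule abs_summable_on_comparison_test'[where f = "kernel p q r s" and g = "\<lambda>a. 16 * (1 / (m1 a ^ Suc e * m2 a * m3 a * m4 a))", unfolded real_norm_def])
  show "(\<lambda>a. 16 * (1 / (m1 a ^ Suc e * m2 a * m3 a * m4 a))) summable_on A"
    by (rule summable_on_cmult_right[OF sm])
  fix a assume "a \<in> A"
  note g = ge1[OF this]
  have d: "m - y \<ge> m / 2" "0 < m - y" if "m \<ge> 1" "\<bar>y\<bar> \<le> 1/2" for m y :: real
    using that by (auto simp: abs_le_iff)
  have "\<bar>p / m1 a\<bar> \<le> 1 / m1 a" using g assms(1) by (simp add: divide_right_mono)
  then have num: "\<bar>(p / m1 a) ^ e\<bar> \<le> (1 / m1 a) ^ e" unfolding power_abs by (intro power_mono) auto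
  \<comment> \<open>Each of the four factors loses at most a factor 2, hence the 16.\<close>
  have den: "(m1 a / 2) * (m2 a / 2) * (m3 a / 2) * (m4 a / 2) \<le> (m1 a - p) * (m2 a - q) * (m3 a - r) * (m4 a - s)"
    using g d(1)[of "m1 a" p] d(1)[of "m2 a" q] d(1)[of "m3 a" r] d(1)[of "m4 a" s] assms
    by (intro mult_mono mult_nonneg_nonneg) auto
  have pos: "0 < (m1 a - p) * (m2 a - q) * (m3 a - r) * (m4 a - s)"
    using g assms by (intro mult_pos_pos d(2)) auto
  have "\<bar>kernel p q r s a\<bar> = \<bar>(p / m1 a) ^ e\<bar> / ((m1 a - p) * (m2 a - q) * (m3 a - r) * (m4 a - s))"
    using pos by (simp add: kernel_def abs_divide del: zero_less_mult_iff)
  also have "\<dots> \<le> (1 / m1 a) ^ e / ((m1 a / 2) * (m2 a / 2) * (m3 a / 2) * (m4 a / 2))"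
    by (rule frac_le[OF _ num _ den]) (use g in auto)
  also have "\<dots> = 16 * (1 / (m1 a ^ Suc e * m2 a * m3 a * m4 a))"
    using g by (simp add: power_divide)
  finally show "\<bar>kernel p q r s a\<bar> \<le> 16 * (1 / (m1 a ^ Suc e * m2 a * m3 a * m4 a))" .
qed

lemma kernel_has_sum:
  assumes "\<bar>p\<bar> \<le> 1/2" "\<bar>q\<bar> \<le> 1/2" "\<bar>r\<bar> \<le> 1/2" "\<bar>s\<bar> \<le> 1/2"
  shows "((\<lambda>k. (case k of (k1, k2, k3, k4) \<Rightarrow> p ^ k1 * q ^ k2 * r ^ k3 * s ^ k4) * weight k)
    has_sum infsum (kernel p q r s) A) (quads e)"
proof -
  define f where "f = (\<lambda>p q r s a (k1::nat, k2::nat, k3::nat, k4::nat).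
    p ^ k1 / m1 a ^ Suc k1 * (q ^ k2 / m2 a ^ Suc k2 * (r ^ k3 / m3 a ^ Suc k3 * (s ^ k4 / m4 a ^ Suc k4))))"
  have geo: "(f p q r s a has_sum kernel p q r s a) (quads e)" "(\<lambda>k. \<bar>f p q r s a k\<bar>) summable_on quads e"
    if a: "a \<in> A" and y: "\<bar>p\<bar> \<le> 1/2" "\<bar>q\<bar> \<le> 1/2" "\<bar>r\<bar> \<le> 1/2" "\<bar>s\<bar> \<le> 1/2" for a p q r s
  proof -
    have g: "m1 a \<ge> 1" "m2 a \<ge> 1" "m3 a \<ge> 1" "m4 a \<ge> 1" using ge1[OF a] by auto
    note G1 = geometric_has_sum[OF g(1) y(1), of e] and G2 = geometric_has_sum[OF g(2) y(2), of 0]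
      and G3 = geometric_has_sum[OF g(3) y(3), of 0] and G4 = geometric_has_sum[OF g(4) y(4), of 0]
    note H34 = has_sum_times[OF G3(1) G4(1) G3(2) G4(2)]
    note H234 = has_sum_times[OF G2(1) H34(1) G2(2) H34(2)]
    note H = has_sum_times[OF G1(1) H234(1) G1(2) H234(2)]
    show "(f p q r s a has_sum kernel p q r s a) (quads e)"
      using H(1) by (simp add: f_def quads_def kernel_def case_prod_unfold mult_ac)
    show "(\<lambda>k. \<bar>f p q r s a k\<bar>) summable_on quads e"
      using H(2) by (simp add: f_def quads_def case_prod_unfold mult_ac)
  qed
  \<comment> \<open>Passing to the absolute values of the parameters makes all terms nonnegative, so
    absolute summability of the double family reduces to \<open>kernel_summable\<close> at those
    parameters.\<close>
  have abs: "\<bar>f p q r s a k\<bar> = f \<bar>p\<bar> \<bar>q\<bar> \<bar>r\<bar> \<bar>s\<bar> a k" if "a \<in> A" for a k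
    using ge1[OF that] by (simp add: f_def case_prod_unfold abs_mult power_abs)
  have "(\<lambda>z. norm (case z of (a, k) \<Rightarrow> f p q r s a k)) summable_on A \<times> quads e"
    unfolding abs_summable_on_Sigma_iff
  proof (intro conjI ballI)
    show "(\<lambda>k. norm (case (a, k) of (a, k) \<Rightarrow> f p q r s a k)) summable_on quads e" if "a \<in> A" for a
      using geo(2)[OF that assms] by simp
    have "infsum (\<lambda>k. \<bar>f p q r s a k\<bar>) (quads e) = kernel \<bar>p\<bar> \<bar>q\<bar> \<bar>r\<bar> \<bar>s\<bar> a" if "a \<in> A" for a
      using geo(1)[OF that, of "\<bar>p\<bar>" "\<bar>q\<bar>" "\<bar>r\<bar>" "\<bar>s\<bar>"] assms by (simp add: abs[OF that] infsumI)
    then show "(\<lambda>a. norm (infsum (\<lambda>k. norm (case (a, k) of (a, k) \<Rightarrow> f p q r s a k)) (quads e))) summable_on A"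
      using kernel_summable[of "\<bar>p\<bar>" "\<bar>q\<bar>" "\<bar>r\<bar>" "\<bar>s\<bar>"] assms by (simp cong: summable_on_cong)
  qed
  then have S: "(\<lambda>(a, k). f p q r s a k) summable_on A \<times> quads e" by (rule abs_summable_summable)
  have S': "(\<lambda>(k, a). f p q r s a k) summable_on quads e \<times> A"
    using summable_on_swap[THEN iffD1, OF S] by (simp add: case_prod_unfold)
  have w: "infsum (\<lambda>a. f p q r s a k) A = (case k of (k1, k2, k3, k4) \<Rightarrow> p ^ k1 * q ^ k2 * r ^ k3 * s ^ k4) * weight k" for k
    unfolding weight_def f_def by (cases k) (simp add: infsum_cmult_right'[symmetric] mult_ac)
  have 1: "(\<lambda>k. infsum (\<lambda>a. f p q r s a k) A) summable_on quads e"
    by (rule summable_on_Sigma_banach[OF S'])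
  have 2: "infsum (\<lambda>k. infsum (\<lambda>a. f p q r s a k) A) (quads e) = infsum (kernel p q r s) A"
  proof -
    have "infsum (\<lambda>k. infsum (\<lambda>a. f p q r s a k) A) (quads e) = infsum (\<lambda>a. infsum (f p q r s a) (quads e)) A"
      by (rule infsum_swap_banach[OF S'])
    also have "\<dots> = infsum (kernel p q r s) A"
      by (rule infsum_cong) (use geo(1)[OF _ assms] infsumI in blast)
    finally show ?thesis .
  qed
  show ?thesis using has_sum_infsum[OF 1] unfolding 2 unfolding w .
qed

definition slice :: "nat \<Rightarrow> (nat \<times> nat \<times> nat \<times> nat) set" where
  "slice d = {(k1, k2, k3, k4). k1 \<ge> e \<and> k1 + k2 + k3 + k4 = d}"

lemma finite_slice: "finite (slice d)"
proof (rule finite_subset)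
  show "slice d \<subseteq> {..d} \<times> {..d} \<times> {..d} \<times> {..d}" by (auto simp: slice_def)
qed auto

text \<open>Scaling all parameters by t grades the expansion by total degree, with only finitely
  many exponents in each degree.\<close>

lemma kernel_sums:
  assumes "\<bar>p\<bar> \<le> 1/2" "\<bar>q\<bar> \<le> 1/2" "\<bar>r\<bar> \<le> 1/2" "\<bar>s\<bar> \<le> 1/2" "\<bar>t\<bar> \<le> 1"
  shows "(\<lambda>d. (\<Sum>(k1, k2, k3, k4)\<in>slice d. p ^ k1 * q ^ k2 * r ^ k3 * s ^ k4 * weight (k1, k2, k3, k4)) * t ^ d)
    sums infsum (kernel (t * p) (t * q) (t * r) (t * s)) A"
proof -
  let ?f = "\<lambda>k. (case k of (k1, k2, k3, k4) \<Rightarrow> (t * p) ^ k1 * (t * q) ^ k2 * (t * r) ^ k3 * (t * s) ^ k4) * weight k"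
  have b: "\<bar>t * y\<bar> \<le> 1/2" if "\<bar>y\<bar> \<le> 1/2" for y
    using mult_mono[of "\<bar>t\<bar>" 1 "\<bar>y\<bar>" "1/2"] that assms(5) by (simp add: abs_mult)
  have "(?f has_sum infsum (kernel (t * p) (t * q) (t * r) (t * s)) A) (quads e)"
    by (rule kernel_has_sum) (use assms b in auto)
  then have "((\<lambda>(d, k). ?f k) has_sum infsum (kernel (t * p) (t * q) (t * r) (t * s)) A) (Sigma UNIV slice)"
    by (subst has_sum_reindex_bij_witness[of _ "\<lambda>k. (case k of (k1, k2, k3, k4) \<Rightarrow> k1 + k2 + k3 + k4, k)" snd "quads e" ?f])
       (auto simp: quads_def slice_def)
  then have "((\<lambda>d. \<Sum>k\<in>slice d. ?f k) has_sum infsum (kernel (t * p) (t * q) (t * r) (t * s)) A) UNIV"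
    by (rule has_sum_SigmaD) (simp add: has_sum_finiteI finite_slice)
  moreover have "(\<Sum>k\<in>slice d. ?f k) =
    (\<Sum>(k1, k2, k3, k4)\<in>slice d. p ^ k1 * q ^ k2 * r ^ k3 * s ^ k4 * weight (k1, k2, k3, k4)) * t ^ d" for d
    unfolding sum_distrib_right
    by (rule sum.cong) (auto simp: slice_def power_mult_distrib power_add)
  ultimately show ?thesis by (auto dest: has_sum_imp_sums)
qed

end

lemma altsum_scale:
  "altsum F (t * a) (t * b) (t * c) (t * d) = altsum (\<lambda>p q r s. F (t * p) (t * q) (t * r) (t * s)) a b c d"
  unfolding altsum_def altwords_def words1111_def words211_def words31_def words22_def
  by (simp add: distrib_left)

lemma powser_const_coeffs:
  fixes c :: "nat \<Rightarrow> real"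
  assumes "\<And>t. \<bar>t\<bar> < 1 \<Longrightarrow> (\<lambda>d. c d * t ^ d) sums K" "n \<ge> 1"
  shows "c n = 0"
proof -
  define f where "f = (\<lambda>d. if d = 0 then c 0 - K else c d)"
  have f: "(\<lambda>d. f d * t ^ d) sums 0" if "\<bar>t\<bar> < 1" for t
  proof -
    have "(\<lambda>d. c d * t ^ d - (if d = 0 then K else 0)) sums (K - K)"
      by (intro sums_diff assms(1) that sums_single)
    moreover have "(\<lambda>d. c d * t ^ d - (if d = 0 then K else 0)) = (\<lambda>d. f d * t ^ d)"
      by (auto simp: f_def fun_eq_iff)
    ultimately show ?thesis by simp
  qed
  have "f n = 0" for n
  proof (induction n rule: less_induct)
    case (less n)
    have "((\<lambda>_. 0) \<longlongrightarrow> f (0 + n)) (at (0::real))"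
    proof (rule powser_limit_0_strong[where a = "\<lambda>d. f (d + n)" and s = 1])
      fix t :: real assume t: "t \<noteq> 0" "norm t < 1"
      have "(\<lambda>d. f (d + n) * t ^ (d + n)) sums (0 - (\<Sum>d<n. f d * t ^ d))"
        by (rule sums_split_initial_segment[OF f]) (use t in simp)
      then have "(\<lambda>d. f (d + n) * t ^ (d + n) / t ^ n) sums (0 / t ^ n)"
        using less.IH by (intro sums_divide) simp
      then show "(\<lambda>d. f (d + n) * t ^ d) sums 0" using t by (simp add: power_add)
    qed simp
    then show ?case using tendsto_const_iff[of "at (0::real)" 0 "f n"] by simp
  qed
  from this[of n] show ?thesis using assms(2) by (simp add: f_def)
qed

section \<open>Decreasing quadruples and the diagonal as index families\<close>

definition below :: "nat \<Rightarrow> (nat \<times> nat \<times> nat) set" where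
  "below m = Sigma {..<m} (\<lambda>i. Sigma {..<i} (\<lambda>j. {..<j}))"

lemma finite_below: "finite (below m)"
  by (simp add: below_def)

lemma hsum_below:
  "hsum [q, r, s] m = (\<Sum>(i, j, k)\<in>below m. 1 / ((real (Suc i) - q) * (real (Suc j) - r) * (real (Suc k) - s)))"
  unfolding below_def
  by (simp add: sum.Sigma[symmetric] sum_divide_distrib mult_ac del: of_nat_Suc)

definition decreasing4 :: "nat list set" where
  "decreasing4 = {ms. length ms = 4 \<and> sorted_wrt (>) ms \<and> (\<forall>m\<in>set ms. 0 < m)}"

lemma bij_betw_decreasing4:
  "bij_betw (\<lambda>(m, i, j, k). [Suc m, Suc i, Suc j, Suc k]) (Sigma UNIV below) decreasing4"
proof (rule bij_betw_byWitness[where f' = "\<lambda>ms. (ms ! 0 - 1, ms ! 1 - 1, ms ! 2 - 1, ms ! 3 - 1)"])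
  have *: "\<exists>a b c d. ms = [a, b, c, d] \<and> a > b \<and> b > c \<and> c > d \<and> d > 0" if "ms \<in> decreasing4" for ms
    using that by (auto simp: decreasing4_def numeral_eq_Suc length_Suc_conv)
  show "\<forall>ms\<in>decreasing4. (case (ms ! 0 - 1, ms ! 1 - 1, ms ! 2 - 1, ms ! 3 - 1) of (m, i, j, k) \<Rightarrow> [Suc m, Suc i, Suc j, Suc k]) = ms"
    using * by fastforce
  show "(\<lambda>ms. (ms ! 0 - 1, ms ! 1 - 1, ms ! 2 - 1, ms ! 3 - 1)) ` decreasing4 \<subseteq> Sigma UNIV below"
    using * by (fastforce simp: below_def)
qed (auto simp: decreasing4_def below_def)

text \<open>Taking \<open>e\<close> as 1 gives the largest entry the exponent 2. Against an inner
  sum of size O(sqrt m) this leaves O(m^(-3/2)), which is summable.\<close>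

interpretation chain_family: quad_family decreasing4
  "\<lambda>ms. real (ms ! 0)" "\<lambda>ms. real (ms ! 1)" "\<lambda>ms. real (ms ! 2)" "\<lambda>ms. real (ms ! 3)" 1
proof
  fix ms assume "ms \<in> decreasing4"
  then show "1 \<le> real (ms ! 0) \<and> 1 \<le> real (ms ! 1) \<and> 1 \<le> real (ms ! 2) \<and> 1 \<le> real (ms ! 3)"
    by (auto simp: decreasing4_def numeral_eq_Suc length_Suc_conv)
next
  define h where "h = (\<lambda>(m, i, j, k). (1 / real (Suc m) ^ 2) * (1 / (real (Suc i) * real (Suc j) * real (Suc k))))"
  have h: "infsum (\<lambda>y. norm (h (m, y))) (below m) = hsum [0, 0, 0] m / real (Suc m) ^ 2" for m
    unfolding hsum_below infsum_finite[OF finite_below] sum_divide_distrib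
    by (rule sum.cong) (auto simp: h_def)
  obtain C where C: "C \<ge> 0" "\<And>n. \<bar>hsum [0, 0, 0] n\<bar> \<le> C * sqrt (real (Suc n))"
    using hsum_bound[of "[0, 0, 0]"] by auto
  have "\<bar>hsum [0, 0, 0] m / real (Suc m) ^ 2\<bar> \<le> C / (real (Suc m) * sqrt (real (Suc m)))" for m
  proof -
    have "\<bar>hsum [0, 0, 0] m / real (Suc m) ^ 2\<bar> = \<bar>hsum [0, 0, 0] m\<bar> / real (Suc m) ^ 2"
      by (simp only: abs_divide power_abs abs_of_nat)
    also have "\<dots> \<le> C * sqrt (real (Suc m)) / real (Suc m) ^ 2"
      by (intro divide_right_mono C) simp
    also have "\<dots> = C * (sqrt (real (Suc m)) / real (Suc m)) / real (Suc m)"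
      by (simp add: power2_eq_square)
    also have "\<dots> = C / (real (Suc m) * sqrt (real (Suc m)))"
      unfolding sqrt_divide_self_eq[OF of_nat_0_le_iff] by (simp add: inverse_eq_divide mult.commute)
    finally show ?thesis .
  qed
  then have "summable (\<lambda>m. \<bar>hsum [0, 0, 0] m / real (Suc m) ^ 2\<bar>)"
    by (rule summable_pow32_bound)
  then have "(\<lambda>m. \<bar>hsum [0, 0, 0] m / real (Suc m) ^ 2\<bar>) summable_on UNIV"
    by (subst summable_on_UNIV_nonneg_real_iff) auto
  then have "(\<lambda>z. norm (h z)) summable_on Sigma UNIV below"
    unfolding abs_summable_on_Sigma_iff h by (simp add: finite_below del: hsum.simps)
  then have "h summable_on Sigma UNIV below" by (rule abs_summable_summable)
  moreover define k where "k = (\<lambda>ms. 1 / (real (ms ! 0) ^ Suc 1 * real (ms ! 1) * real (ms ! 2) * real (ms ! 3)))"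
  have "h = (\<lambda>z. k ((\<lambda>(m, i, j, k). [Suc m, Suc i, Suc j, Suc k]) z))"
    by (auto simp: h_def k_def power2_eq_square fun_eq_iff)
  ultimately have "(\<lambda>z. k ((\<lambda>(m, i, j, k). [Suc m, Suc i, Suc j, Suc k]) z)) summable_on Sigma UNIV below"
    by simp
  then have "k summable_on decreasing4"
    by (rule summable_on_reindex_bij_betw[OF bij_betw_decreasing4, THEN iffD1])
  then show "(\<lambda>ms. 1 / (real (ms ! 0) ^ Suc 1 * real (ms ! 1) * real (ms ! 2) * real (ms ! 3))) summable_on decreasing4"
    unfolding k_def .
qed

lemma infsum_chain_kernel:
  assumes "\<bar>p\<bar> \<le> 1/2" "\<bar>q\<bar> \<le> 1/2" "\<bar>r\<bar> \<le> 1/2" "\<bar>s\<bar> \<le> 1/2"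
  shows "infsum (chain_family.kernel p q r s) decreasing4 = mzv_gf p q r s"
proof -
  define g where "g = (\<lambda>(m, i, j, k). chain_family.kernel p q r s [Suc m, Suc i, Suc j, Suc k])"
  have g: "g z = chain_family.kernel p q r s ((\<lambda>(m, i, j, k). [Suc m, Suc i, Suc j, Suc k]) z)" for z
    by (cases z) (simp add: g_def)
  have "chain_family.kernel p q r s summable_on decreasing4"
    using abs_summable_summable[of "chain_family.kernel p q r s"] chain_family.kernel_summable[OF assms] by simp
  then have sm: "g summable_on Sigma UNIV below"
    unfolding g by (subst summable_on_reindex_bij_betw[OF bij_betw_decreasing4])
  have inner: "infsum (\<lambda>y. g (m, y)) (below m) = (1 / (real (Suc m) - p) - 1 / real (Suc m)) * hsum [q, r, s] m" for m
  proof -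
    have "real (Suc m) - p \<noteq> 0" using half_le_diff[OF assms(1), of m] by simp
    then have "1 / (real (Suc m) - p) - 1 / real (Suc m) = p / real (Suc m) / (real (Suc m) - p)"
      by (simp add: field_simps)
    then show ?thesis
      unfolding infsum_finite[OF finite_below] hsum_below sum_distrib_left g_def chain_family.kernel_def
      by (intro sum.cong) auto
  qed
  have "infsum (chain_family.kernel p q r s) decreasing4 = infsum g (Sigma UNIV below)"
    unfolding g by (rule infsum_reindex_bij_betw[OF bij_betw_decreasing4, symmetric])
  also have "\<dots> = infsum (\<lambda>m. infsum (\<lambda>y. g (m, y)) (below m)) UNIV"
    by (rule infsum_Sigma_banach[OF sm, symmetric])
  also have "\<dots> = mzv_gf p q r s"
  proof -
    have "(\<lambda>m. infsum (\<lambda>y. g (m, y)) (below m)) summable_on UNIV"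
      by (rule summable_on_Sigma_banach) (use sm in simp)
    from has_sum_imp_sums[OF has_sum_infsum[OF this]] show ?thesis
      unfolding inner mzv_gf_def by (rule sums_unique)
  qed
  finally show ?thesis .
qed

lemma chain_weight: "chain_family.weight (k1, k2, k3, k4) = mzv [Suc k1, Suc k2, Suc k3, Suc k4]"
  unfolding chain_family.weight_def mzv_def
  by (simp add: decreasing4_def numeral_eq_Suc lessThan_Suc mult_ac)

interpretation diag_family: quad_family UNIV
  "\<lambda>m. real (Suc m)" "\<lambda>m. real (Suc m)" "\<lambda>m. real (Suc m)" "\<lambda>m. real (Suc m)" 0
proof
  have "summable (\<lambda>m. 1 / real (Suc m) ^ 4)"
    using inverse_power_summable[of 4, where ?'a = real] by (subst summable_Suc_iff) (simp add: inverse_eq_divide)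
  then have "(\<lambda>m. 1 / real (Suc m) ^ 4) summable_on UNIV"
    by (subst summable_on_UNIV_nonneg_real_iff) auto
  then show "(\<lambda>m. 1 / (real (Suc m) ^ Suc 0 * real (Suc m) * real (Suc m) * real (Suc m))) summable_on UNIV"
    by (simp add: power4_eq_xxxx)
qed simp

lemma diag_weight: "diag_family.weight (k1, k2, k3, k4) = zeta_nat (k1 + k2 + k3 + k4 + 4)"
proof -
  have "summable (\<lambda>m. 1 / real (Suc m) ^ (k1 + k2 + k3 + k4 + 4))"
    using inverse_power_summable[of "k1 + k2 + k3 + k4 + 4", where ?'a = real] by (subst summable_Suc_iff) (simp add: inverse_eq_divide)
  then have "(\<lambda>m. 1 / real (Suc m) ^ (k1 + k2 + k3 + k4 + 4)) summable_on UNIV"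
    by (subst summable_on_UNIV_nonneg_real_iff) auto
  from has_sum_imp_sums[OF has_sum_infsum[OF this]]
  have "zeta_nat (k1 + k2 + k3 + k4 + 4) = infsum (\<lambda>m. 1 / real (Suc m) ^ (k1 + k2 + k3 + k4 + 4)) UNIV"
    unfolding zeta_nat_def by (rule sums_unique[symmetric])
  then show ?thesis
    unfolding diag_family.weight_def by (simp add: power_add mult_ac power4_eq_xxxx del: of_nat_Suc)
qed

lemma diag_kernel:
  "diag_family.kernel p q r s m = 1 / ((real (Suc m) - p) * (real (Suc m) - q) * (real (Suc m) - r) * (real (Suc m) - s))"
  unfolding diag_family.kernel_def by simp

lemma altsum_sums:
  fixes f :: "nat \<Rightarrow> real \<Rightarrow> real \<Rightarrow> real \<Rightarrow> real \<Rightarrow> real"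
  assumes "\<bar>a\<bar> \<le> 1/8" "\<bar>b\<bar> \<le> 1/8" "\<bar>c\<bar> \<le> 1/8" "\<bar>d\<bar> \<le> 1/8"
    and "\<And>p q r s. small [p, q, r, s] \<Longrightarrow> (\<lambda>n. f n p q r s * x n) sums g p q r s"
  shows "(\<lambda>n. altsum (f n) a b c d * x n) sums altsum g a b c d"
proof -
  have "(\<lambda>n. (\<Sum>(e, p, q, r, s)\<leftarrow>ws. of_int e * f n p q r s) * x n) sums (\<Sum>(e, p, q, r, s)\<leftarrow>ws. of_int e * g p q r s)"
    if "\<forall>(e, p, q, r, s)\<in>set ws. small [p, q, r, s]" for ws
    using that
  proof (induction ws)
    case (Cons w ws)
    obtain e p q r s where w: "w = (e, p, q, r, s)" by (cases w)
    have "(\<lambda>n. of_int e * (f n p q r s * x n)) sums (of_int e * g p q r s)"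
      using Cons.prems w by (intro sums_mult assms(5)) auto
    from sums_add[OF this Cons.IH] show ?case using Cons.prems unfolding w by (simp add: algebra_simps)
  qed simp
  then show ?thesis
    unfolding altsum_def using altwords_small[OF assms(1-4)] by blast
qed

text \<open>With all parameters multiplied by t, \<open>altsum_mzv_gf\<close> says that two power
  series in t differ by the constant zeta(4). Their coefficients at t^n hence agree for n >= 1, and
  degree n belongs to weight n + 4.\<close>

theorem altsum_mzv:
  assumes "\<bar>a\<bar> \<le> 1/8" "\<bar>b\<bar> \<le> 1/8" "\<bar>c\<bar> \<le> 1/8" "\<bar>d\<bar> \<le> 1/8" "n \<ge> 1"
  shows "altsum (\<lambda>p q r s. \<Sum>(k1, k2, k3, k4)\<in>chain_family.slice n.
      p ^ k1 * q ^ k2 * r ^ k3 * s ^ k4 * mzv [Suc k1, Suc k2, Suc k3, Suc k4]) a b c d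
    = (\<Sum>(k1, k2, k3, k4)\<in>diag_family.slice n. a ^ k1 * b ^ k2 * c ^ k3 * d ^ k4) * zeta_nat (n + 4)"
proof -
  define G where "G = (\<lambda>n p q r s. \<Sum>(k1, k2, k3, k4)\<in>chain_family.slice n.
      p ^ k1 * q ^ k2 * r ^ k3 * s ^ k4 * mzv [Suc k1, Suc k2, Suc k3, Suc k4])"
  define E where "E = (\<lambda>n. \<Sum>(k1, k2, k3, k4)\<in>diag_family.slice n. a ^ k1 * b ^ k2 * c ^ k3 * d ^ k4 * zeta_nat (k1 + k2 + k3 + k4 + 4))"
  have "E n - altsum (G n) a b c d = 0"
  proof (rule powser_const_coeffs[where c = "\<lambda>n. E n - altsum (G n) a b c d", OF _ assms(5)])
    fix t :: real assume t: "\<bar>t\<bar> < 1"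
    have b8: "\<bar>t * y\<bar> \<le> 1/8" if "\<bar>y\<bar> \<le> 1/8" for y
      using mult_mono[of "\<bar>t\<bar>" 1 "\<bar>y\<bar>" "1/8"] that t by (simp add: abs_mult)
    have b2: "\<bar>t * y\<bar> \<le> 1/2" if "\<bar>y\<bar> \<le> 1/2" for y
      using mult_mono[of "\<bar>t\<bar>" 1 "\<bar>y\<bar>" "1/2"] that t by (simp add: abs_mult)
    have "(\<lambda>n. G n p q r s * t ^ n) sums mzv_gf (t * p) (t * q) (t * r) (t * s)" if "small [p, q, r, s]" for p q r s
    proof -
      have y: "\<bar>p\<bar> \<le> 1/2" "\<bar>q\<bar> \<le> 1/2" "\<bar>r\<bar> \<le> 1/2" "\<bar>s\<bar> \<le> 1/2" using that by auto
      from chain_family.kernel_sums[OF y less_imp_le[OF t]]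
      show ?thesis
        unfolding infsum_chain_kernel[OF y[THEN b2]] chain_weight G_def .
    qed
    from altsum_sums[OF assms(1-4) this] have 1: "(\<lambda>n. altsum (G n) a b c d * t ^ n) sums altsum mzv_gf (t * a) (t * b) (t * c) (t * d)"
      unfolding altsum_scale .
    have "(\<lambda>n. E n * t ^ n) sums infsum (diag_family.kernel (t * a) (t * b) (t * c) (t * d)) UNIV"
    proof -
      have y: "\<bar>a\<bar> \<le> 1/2" "\<bar>b\<bar> \<le> 1/2" "\<bar>c\<bar> \<le> 1/2" "\<bar>d\<bar> \<le> 1/2" using assms by auto
      from diag_family.kernel_sums[OF y less_imp_le[OF t]]
      show ?thesis unfolding diag_weight E_def .
    qed
    moreover have "infsum (diag_family.kernel (t * a) (t * b) (t * c) (t * d)) UNIV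
      = altsum mzv_gf (t * a) (t * b) (t * c) (t * d) + suminf (\<lambda>m. 1 / real (Suc m) ^ 4)"
    proof -
      have "diag_family.kernel (t * a) (t * b) (t * c) (t * d) summable_on UNIV"
      proof (rule abs_summable_summable, unfold real_norm_def, rule diag_family.kernel_summable)
        show "\<bar>t * a\<bar> \<le> 1/2" "\<bar>t * b\<bar> \<le> 1/2" "\<bar>t * c\<bar> \<le> 1/2" "\<bar>t * d\<bar> \<le> 1/2"
          by (intro b2; use assms in linarith)+
      qed
      from has_sum_imp_sums[OF has_sum_infsum[OF this]]
        altsum_mzv_gf[OF b8[OF assms(1)] b8[OF assms(2)] b8[OF assms(3)] b8[OF assms(4)]]
      show ?thesis unfolding diag_kernel by (rule sums_unique2)
    qed
    ultimately have "(\<lambda>n. E n * t ^ n - altsum (G n) a b c d * t ^ n) sums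
      (altsum mzv_gf (t * a) (t * b) (t * c) (t * d) + suminf (\<lambda>m. 1 / real (Suc m) ^ 4) - altsum mzv_gf (t * a) (t * b) (t * c) (t * d))"
      using 1 by (intro sums_diff) auto
    then show "(\<lambda>n. (E n - altsum (G n) a b c d) * t ^ n) sums suminf (\<lambda>m. 1 / real (Suc m) ^ 4)"
      by (simp only: left_diff_distrib add_diff_cancel_left')
  qed
  moreover have "E n = (\<Sum>(k1, k2, k3, k4)\<in>diag_family.slice n. a ^ k1 * b ^ k2 * c ^ k3 * d ^ k4) * zeta_nat (n + 4)"
    unfolding E_def sum_distrib_right by (rule sum.cong) (auto simp: diag_family.slice_def)
  ultimately show ?thesis unfolding G_def by simp
qed

section \<open>Evaluation of polynomials and the sums over permutations\<close>

definition ev :: "(nat \<Rightarrow> complex) \<Rightarrow> cpoly \<Rightarrow> complex" where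
  "ev v f = (\<Sum>m\<in>Poly_Mapping.keys f. Poly_Mapping.lookup f m *
     (\<Prod>i\<in>Poly_Mapping.keys m. v i ^ Poly_Mapping.lookup m i))"

lemma ev_superset:
  assumes "finite M" "Poly_Mapping.keys f \<subseteq> M"
  shows "ev v f = (\<Sum>m\<in>M. Poly_Mapping.lookup f m *
     (\<Prod>i\<in>Poly_Mapping.keys m. v i ^ Poly_Mapping.lookup m i))"
  unfolding ev_def
  by (rule sum.mono_neutral_left) (use assms in \<open>auto simp: in_keys_iff\<close>)

lemma ev_0 [simp]: "ev v 0 = 0"
  by (simp add: ev_def)

lemma ev_add: "ev v (f + g) = ev v f + ev v g"
proof -
  let ?M = "Poly_Mapping.keys f \<union> Poly_Mapping.keys g"
  have "Poly_Mapping.keys (f + g) \<subseteq> ?M"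
    by (rule Poly_Mapping.keys_add)
  then show ?thesis
    by (simp add: ev_superset[of ?M] lookup_add distrib_right sum.distrib)
qed

lemma ev_single:
  "ev v (Poly_Mapping.single m c) = c * (\<Prod>i\<in>Poly_Mapping.keys m. v i ^ Poly_Mapping.lookup m i)"
  by (subst ev_superset[of "{m}"]) auto

lemma prod_power_lookup_add:
  fixes v :: "nat \<Rightarrow> complex"
  shows "(\<Prod>i\<in>Poly_Mapping.keys (m + n). v i ^ Poly_Mapping.lookup (m + n) i) =
   (\<Prod>i\<in>Poly_Mapping.keys m. v i ^ Poly_Mapping.lookup m i) *
   (\<Prod>i\<in>Poly_Mapping.keys n. v i ^ Poly_Mapping.lookup n i)"
proof -
  let ?K = "Poly_Mapping.keys m \<union> Poly_Mapping.keys n"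
  have K: "(\<Prod>i\<in>Poly_Mapping.keys p. v i ^ Poly_Mapping.lookup p i) =
      (\<Prod>i\<in>?K. v i ^ Poly_Mapping.lookup p i)" if "Poly_Mapping.keys p \<subseteq> ?K" for p
    by (rule prod.mono_neutral_left) (use that in \<open>auto simp: in_keys_iff\<close>)
  show ?thesis
    unfolding K[OF Poly_Mapping.keys_add] K[OF Un_upper1] K[OF Un_upper2]
    by (simp add: lookup_add power_add prod.distrib)
qed

lemma ev_mult: "ev v (f * g) = ev v f * ev v g"
proof -
  have 1: "ev v (Poly_Mapping.single m c * g) = ev v (Poly_Mapping.single m c) * ev v g" for m c
    by (induction g rule: cpoly_induct)
       (simp_all add: distrib_left ev_add mult_single ev_single prod_power_lookup_add mult_ac)
  show ?thesis
    by (induction f rule: cpoly_induct) (simp_all add: distrib_right ev_add 1)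
qed

lemma ev_indet [simp]: "ev v (indet i) = v i"
  by (simp add: indet_def ev_single)

lemma ev_scalar [simp]: "ev v (scalar c) = c"
  by (simp add: scalar_def ev_single)

lemma ev_1 [simp]: "ev v 1 = 1"
  using ev_scalar[of v 1] by (simp add: scalar_def)

lemma ev_diff: "ev v (f - g) = ev v f - ev v g"
  using ev_add[of v "f - g" g] by simp

lemma ev_power: "ev v (f ^ k) = ev v f ^ k"
  by (induction k) (simp_all add: ev_mult)

lemma ev_sum: "ev v (sum f A) = (\<Sum>a\<in>A. ev v (f a))"
  by (induction A rule: infinite_finite_induct) (simp_all add: ev_add)

lemma ev_xpow: "ev v (xpow js k) = (\<Sum>j\<leftarrow>js. v j) ^ k"
proof -
  have "ev v (\<Sum>j\<leftarrow>js. indet j) = (\<Sum>j\<leftarrow>js. v j)"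
    by (induction js) (simp_all add: ev_add)
  then show ?thesis by (simp add: xpow_def ev_power)
qed

text \<open>Uniqueness of base \<open>B\<close> digits gives distinct monomials distinct exponents
  after the Kronecker substitution.\<close>

lemma digits_inject:
  fixes a b :: "nat \<Rightarrow> nat"
  assumes "\<And>i. a i < B" "\<And>i. b i < B" "(\<Sum>i<n. a i * B ^ i) = (\<Sum>i<n. b i * B ^ i)" "i < n"
  shows "a i = b i"
  using assms
proof (induction n arbitrary: a b i)
  case (Suc n)
  have split: "(\<Sum>i<Suc n. a i * B ^ i) = a 0 + B * (\<Sum>i<n. a (Suc i) * B ^ i)" for a :: "nat \<Rightarrow> nat"
    unfolding sum.lessThan_Suc_shift by (simp add: sum_distrib_left mult_ac)
  have eq: "a 0 + B * (\<Sum>i<n. a (Suc i) * B ^ i) = b 0 + B * (\<Sum>i<n. b (Suc i) * B ^ i)"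
    using Suc.prems(3) unfolding split .
  then have "(a 0 + B * (\<Sum>i<n. a (Suc i) * B ^ i)) mod B = (b 0 + B * (\<Sum>i<n. b (Suc i) * B ^ i)) mod B"
    by simp
  then have "a 0 = b 0" using Suc.prems(1,2) by simp
  moreover have "(\<Sum>i<n. a (Suc i) * B ^ i) = (\<Sum>i<n. b (Suc i) * B ^ i)"
    using eq \<open>a 0 = b 0\<close> Suc.prems(1)[of 0] by simp
  ultimately show ?case
    using Suc.IH[of "\<lambda>i. a (Suc i)" "\<lambda>i. b (Suc i)" "i - 1"] Suc.prems by (cases i) auto
qed simp

text \<open>Kronecker substitution \<open>x\<^sub>i = t\<^bsup>B^i\<^esup>\<close> with a large base \<open>B\<close> separates the finitely many monomials.\<close>

lemma cpoly_eq_0: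
  assumes "\<And>x. (\<And>i. 0 < x i \<and> x i < (1/8 :: real)) \<Longrightarrow> ev (\<lambda>i. of_real (x i)) f = 0"
  shows "f = 0"
proof -
  let ?K = "Poly_Mapping.keys f"
  define I where "I = \<Union> (Poly_Mapping.keys ` ?K)"
  define N where "N = Suc (Max (insert 0 I))"
  define B where "B = Suc (Max (insert 0 ((\<lambda>(m, i). Poly_Mapping.lookup m i) ` (?K \<times> I))))"
  have fin: "finite I" by (simp add: I_def)
  have N: "i < N" if "i \<in> I" for i
    using Max_ge[of "insert 0 I" i] fin that by (simp add: N_def less_Suc_eq_le)
  have B: "Poly_Mapping.lookup m i < B" if "m \<in> ?K" for m i
  proof (cases "i \<in> I")
    case True
    have "Poly_Mapping.lookup m i \<le> Max (insert 0 ((\<lambda>(m, i). Poly_Mapping.lookup m i) ` (?K \<times> I)))"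
      by (rule Max_ge) (use fin True that in force)+
    then show ?thesis by (simp add: B_def)
  next
    case False
    then have "Poly_Mapping.lookup m i = 0" using that by (auto simp: I_def in_keys_iff)
    then show ?thesis by (simp add: B_def)
  qed
  define code where "code = (\<lambda>m. \<Sum>i<N. Poly_Mapping.lookup m i * B ^ i)"
  have inj: "inj_on code ?K"
  proof (rule inj_onI)
    fix m n assume m: "m \<in> ?K" and n: "n \<in> ?K" and eq: "code m = code n"
    show "m = n"
    proof (rule poly_mapping_eqI)
      fix i
      show "Poly_Mapping.lookup m i = Poly_Mapping.lookup n i"
      proof (cases "i < N")
        case True
        show ?thesis
          by (rule digits_inject[OF B[OF m] B[OF n] eq[unfolded code_def] True])
      next
        case False
        then have "i \<notin> Poly_Mapping.keys m" "i \<notin> Poly_Mapping.keys n"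
          using N m n by (auto simp: I_def)
        then show ?thesis by (simp add: in_keys_iff)
      qed
    qed
  qed
  define p where "p = (\<Sum>m\<in>?K. Polynomial.monom (Poly_Mapping.lookup f m) (code m))"
  have "poly p (of_real t) = 0" if t: "0 < t" "t < 1/8" for t :: real
  proof -
    have "0 < t ^ (B ^ i) \<and> t ^ (B ^ i) < 1/8" for i
    proof -
      have "t ^ (B ^ i) \<le> t ^ 1" by (rule power_decreasing) (use t in \<open>auto simp: B_def\<close>)
      then show ?thesis using t by simp
    qed
    from assms[of "\<lambda>i. t ^ (B ^ i)", OF this]
    have "0 = (\<Sum>m\<in>?K. Poly_Mapping.lookup f m * (\<Prod>i\<in>Poly_Mapping.keys m. (of_real t ^ (B ^ i)) ^ Poly_Mapping.lookup m i))"
      by (simp add: ev_def)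
    also have "\<dots> = (\<Sum>m\<in>?K. Poly_Mapping.lookup f m * of_real t ^ code m)"
    proof (rule sum.cong[OF refl])
      fix m assume m: "m \<in> ?K"
      have "i < N" if "i \<in> Poly_Mapping.keys m" for i
        using N[of i] m that unfolding I_def by blast
      then have "(\<Prod>i\<in>Poly_Mapping.keys m. (of_real t ^ (B ^ i)) ^ Poly_Mapping.lookup m i :: complex)
        = (\<Prod>i<N. (of_real t ^ (B ^ i)) ^ Poly_Mapping.lookup m i)"
        by (intro prod.mono_neutral_left) (auto simp: in_keys_iff)
      also have "\<dots> = of_real t ^ code m"
        unfolding code_def power_sum by (simp add: power_mult[symmetric] mult.commute)
      finally show "Poly_Mapping.lookup f m * (\<Prod>i\<in>Poly_Mapping.keys m. (of_real t ^ (B ^ i)) ^ Poly_Mapping.lookup m i)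
        = Poly_Mapping.lookup f m * of_real t ^ code m" by simp
    qed
    finally show ?thesis by (simp add: p_def poly_sum poly_monom)
  qed
  then have "of_real ` {0<..<1/8::real} \<subseteq> {z. poly p z = 0}" by auto
  moreover have "infinite ((of_real :: real \<Rightarrow> complex) ` {0<..<1/8})"
    by (subst finite_image_iff) (auto simp: inj_on_def infinite_Ioo)
  ultimately have "p = 0" using poly_roots_finite[of p] finite_subset by blast
  have "Poly_Mapping.lookup f m = 0" if m: "m \<in> ?K" for m
  proof -
    have "0 = Polynomial.coeff p (code m)" using \<open>p = 0\<close> by simp
    also have "\<dots> = (\<Sum>n\<in>?K. if n = m then Poly_Mapping.lookup f n else 0)"
      unfolding p_def coeff_sum using inj m by (intro sum.cong) (auto simp: inj_on_def)
    also have "\<dots> = Poly_Mapping.lookup f m" using m by simp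
    finally show ?thesis ..
  qed
  then show ?thesis by (metis in_keys_iff keys_eq_empty equals0I)
qed

section \<open>Explicit enumeration of the permutation groups\<close>

lemma gen4_eq:
  assumes "\<sigma> permutes {1..4}" "\<sigma> ^^ n = id" "n > 0"
  shows "gen4 \<sigma> = (\<lambda>k. \<sigma> ^^ k) ` {..<n}"
proof (intro equalityI subsetI)
  have mod: "\<sigma> ^^ (m mod n) = \<sigma> ^^ m" for m
    using assms(2) by (simp add: fun_eq_iff funpow_mod_eq)
  fix \<tau>
  assume "\<tau> \<in> gen4 \<sigma>"
  then have "\<exists>k. \<tau> = \<sigma> ^^ k"
    unfolding gen4_def
  proof induction
    case one
    show ?case by (intro exI[of _ 0]) (simp add: sym_group_one)
  next
    case (incl h)
    then show ?case by (intro exI[of _ 1]) simp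
  next
    case (inv h)
    \<comment> \<open>Finite order makes the inverse a power as well, so the powers are closed under
      every rule of \<open>generate\<close>.\<close>
    have "\<sigma> \<circ> \<sigma> ^^ (n - 1) = id" using assms(2,3) by (cases n) auto
    then have "inv' \<sigma> = \<sigma> ^^ (n - 1)"
      using assms(1) by (metis inv_unique_comp permutes_inv_o(2) comp_assoc comp_id id_comp)
    then show ?case using inv assms(1) by (auto simp: sym_group_inv_equality sym_group_carrier)
  next
    case (eng h1 h2)
    then obtain i j where "h1 = \<sigma> ^^ i" "h2 = \<sigma> ^^ j" by auto
    then show ?case by (intro exI[of _ "i + j"]) (simp only: sym_group_mult funpow_add)
  qed
  then obtain k where "\<tau> = \<sigma> ^^ (k mod n)" using mod by auto
  then show "\<tau> \<in> (\<lambda>k. \<sigma> ^^ k) ` {..<n}" using assms(3) by auto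
next
  fix \<tau> assume "\<tau> \<in> (\<lambda>k. \<sigma> ^^ k) ` {..<n}"
  then obtain k where "\<tau> = \<sigma> ^^ k" by auto
  moreover have "\<sigma> ^^ k \<in> gen4 \<sigma>" for k
  proof (induction k)
    case 0
    have "\<one>\<^bsub>sym_group 4\<^esub> \<in> gen4 \<sigma>" unfolding gen4_def by (rule generate.one)
    then show ?case by (simp add: sym_group_one id_def)
  next
    case (Suc k)
    have "\<sigma> \<in> gen4 \<sigma>" unfolding gen4_def by (rule generate.incl) simp
    from this Suc have "\<sigma> \<otimes>\<^bsub>sym_group 4\<^esub> (\<sigma> ^^ k) \<in> gen4 \<sigma>"
      unfolding gen4_def by (rule generate.eng)
    then show ?case by (simp only: sym_group_mult funpow.simps)
  qed
  ultimately show "\<tau> \<in> gen4 \<sigma>" by simp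
qed

text \<open>Permutations are functions, whose inequality is not visible syntactically; different
  value lists on 1, 2, 3, 4 prove them distinct by evaluation.\<close>

lemma sum_via_list:
  assumes "A = set L" "distinct (map (\<lambda>\<sigma>. map \<sigma> [1, 2, 3, 4 :: nat]) L)"
  shows "sum F A = sum_list (map F (L :: (nat \<Rightarrow> nat) list))"
  using assms by (simp add: distinct_map sum_list_distinct_conv_sum_set)

lemma permutes_cycle_of_list: "set cs \<subseteq> {1..4} \<Longrightarrow> cycle_of_list cs permutes {1..4::nat}"
  using cycle_permutes permutes_subset by blast

lemma cycle_of_list_pow:
  assumes "cycle cs"
  shows "cycle_of_list cs ^^ length cs = id"
proof
  fix x
  show "(cycle_of_list cs ^^ length cs) x = id x"
  proof (cases "x \<in> set cs")
    case True
    have "map (cycle_of_list cs ^^ length cs) cs = map id cs"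
      using cyclic_rotation[OF assms, of "length cs"] by simp
    with True show ?thesis unfolding map_eq_conv by blast
  next
    case False
    have "(cycle_of_list cs ^^ n) x = x" for n
      by (induction n) (simp_all add: id_outside_supp[OF False])
    then show ?thesis by simp
  qed
qed

lemma sum_gen4_list:
  assumes "set cs \<subseteq> {1..4}" "cycle cs" "length cs = n" "n > 0"
    "distinct (map (\<lambda>\<sigma>. map \<sigma> [1, 2, 3, 4]) (map (\<lambda>k. cycle_of_list cs ^^ k) [0..<n]))"
  shows "gen4 (cycle_of_list cs) = set (map (\<lambda>k. cycle_of_list cs ^^ k) [0..<n])"
    "sum F (gen4 (cycle_of_list cs)) = sum_list (map F (map (\<lambda>k. cycle_of_list cs ^^ k) [0..<n]))"
proof -
  show *: "gen4 (cycle_of_list cs) = set (map (\<lambda>k. cycle_of_list cs ^^ k) [0..<n])"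
    using gen4_eq[OF permutes_cycle_of_list[OF assms(1)] cycle_of_list_pow[OF assms(2)]] assms(3,4) by auto
  show "sum F (gen4 (cycle_of_list cs)) = sum_list (map F (map (\<lambda>k. cycle_of_list cs ^^ k) [0..<n]))"
    by (rule sum_via_list[OF * assms(5)])
qed

definition c4 :: "nat \<Rightarrow> nat" where
  "c4 = cycle_of_list [1, 2, 3, 4]"

lemma map_pow:
  "map (\<lambda>k. f ^^ k) [0..<4] = [id, f, f \<circ> f, f \<circ> f \<circ> f]"
  "map (\<lambda>k. f ^^ k) [0..<3] = [id, f, f \<circ> f]"
  "map (\<lambda>k. f ^^ k) [0..<2] = [id, f]"
  by (simp_all add: numeral_eq_Suc comp_assoc)

lemma cycle_values:
  "c4 (Suc 0) = 2" "c4 2 = 3" "c4 3 = 4" "c4 4 = Suc 0"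
  "cycle_of_list [2, 3, 4 :: nat] 2 = 3" "cycle_of_list [2, 3, 4 :: nat] 3 = 4" "cycle_of_list [2, 3, 4 :: nat] 4 = 2"
  "cycle_of_list [2, 4 :: nat] 2 = 4" "cycle_of_list [2, 4 :: nat] 4 = 2"
  "cycle_of_list [3, 4 :: nat] (Suc 0) = Suc 0" "cycle_of_list [3, 4 :: nat] 2 = 2"
  "cycle_of_list [3, 4 :: nat] 3 = 4" "cycle_of_list [3, 4 :: nat] 4 = 3"
  by (simp_all add: c4_def Transposition.transpose_def)

lemma C4_list: "C4 = set [id, c4, c4 \<circ> c4, c4 \<circ> c4 \<circ> c4]"
  unfolding C4_def c4_def[symmetric]
  by (rule sum_gen4_list(1)[where n = 4 and cs = "[1, 2, 3, 4]", unfolded map_pow c4_def[symmetric]]) (simp_all add: cycle_values del: cycle_of_list.simps)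

lemma sum_gen4_234: "sum F (gen4 (cycle_of_list [2, 3, 4])) =
    F id + F (cycle_of_list [2, 3, 4]) + F (cycle_of_list [2, 3, 4] \<circ> cycle_of_list [2, 3, 4])"
  by (subst sum_gen4_list(2)[where n = 3, unfolded map_pow]) (simp_all add: cycle_values add_ac del: cycle_of_list.simps)

lemma sum_gen4_24: "sum F (gen4 (cycle_of_list [2, 4])) = F id + F (cycle_of_list [2, 4])"
  by (subst sum_gen4_list(2)[where n = 2, unfolded map_pow]) (simp_all add: cycle_values del: cycle_of_list.simps)

lemma sum_gen4_34: "sum F (gen4 (cycle_of_list [3, 4])) = F id + F (cycle_of_list [3, 4])"
  by (subst sum_gen4_list(2)[where n = 2, unfolded map_pow]) (simp_all add: cycle_values del: cycle_of_list.simps)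

lemma sum_C4: "sum F C4 = F id + F c4 + F (c4 \<circ> c4) + F (c4 \<circ> c4 \<circ> c4)"
  by (subst sum_via_list[OF C4_list]) (simp_all add: cycle_values add_ac del: cycle_of_list.simps)

text \<open>The eight value lists are distinct, so the coset is disjoint from \<open>C4\<close> and
  the sum splits.\<close>

lemma sum_C4_coset:
  "sum F (C4 \<union> (C4 #>\<^bsub>sym_group 4\<^esub> cycle_of_list [3, 4])) =
    sum F C4 + sum (\<lambda>\<sigma>. F (\<sigma> \<circ> cycle_of_list [3, 4])) C4"
proof -
  let ?L = "[id, c4, c4 \<circ> c4, c4 \<circ> c4 \<circ> c4]"
  have "C4 \<union> (C4 #>\<^bsub>sym_group 4\<^esub> cycle_of_list [3, 4]) = set (?L @ map (\<lambda>\<sigma>. \<sigma> \<circ> cycle_of_list [3, 4]) ?L)"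
    unfolding r_coset_def C4_list sym_group_mult by auto
  from sum_via_list[OF this, of F] show ?thesis
    unfolding sum_C4 by (simp add: cycle_values add_ac del: cycle_of_list.simps)
qed

lemma sum_B4: "sum F B4 = F id + F c4"
proof -
  have "B4 = set [id, c4]" by (simp add: B4_def c4_def)
  from sum_via_list[OF this, of F] show ?thesis by (simp add: cycle_values del: cycle_of_list.simps)
qed

text \<open>Each permutation factors uniquely through transpositions fixing the image of 1, then of
  2, then of 3; on the remaining set {4} only the identity is left.\<close>

lemma sum_S4:
  "sum F S4 = (\<Sum>b\<in>{1, 2, 3, 4}. \<Sum>c\<in>{2, 3, 4}. \<Sum>d\<in>{3, 4}. F (Transposition.transpose 1 b \<circ> (Transposition.transpose 2 c \<circ> Transposition.transpose 3 d)))"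
proof -
  have S4: "S4 = {p. p permutes {1, 2, 3, 4}}"
  proof -
    have "{1..4::nat} = {1, 2, 3, 4}" by auto
    then show ?thesis unfolding S4_def sym_group_carrier[symmetric] by (auto simp: sym_group_carrier)
  qed
  have id: "{p. p permutes {4::nat}} = {id}" by (auto simp: permutes_sing)
  show ?thesis
    unfolding S4 by (simp add: sum_over_permutations_insert id)
qed

section \<open>Identification of the weight polynomials\<close>

definition xpow4 :: "nat \<Rightarrow> nat \<Rightarrow> nat \<Rightarrow> nat \<Rightarrow> nat list \<Rightarrow> nat list \<Rightarrow> nat list \<Rightarrow> nat list \<Rightarrow> cpoly" where
  "xpow4 l1 l2 l3 l4 A B C D = xpow A (l1 - 1) * xpow B (l2 - 1) * xpow C (l3 - 1) * xpow D (l4 - 1)"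

lemma act_xpow4: "\<sigma> \<bullet>\<^sub>S xpow4 l1 l2 l3 l4 A B C D = xpow4 l1 l2 l3 l4 (map \<sigma> A) (map \<sigma> B) (map \<sigma> C) (map \<sigma> D)"
  by (simp add: xpow4_def act_mult act_xpow)

lemma act_diff: "\<sigma> \<bullet>\<^sub>S (f - g) = \<sigma> \<bullet>\<^sub>S f - \<sigma> \<bullet>\<^sub>S g"
  using act_add[of \<sigma> "f - g" g] by (simp add: algebra_simps)

text \<open>The three group sums in \<open>wpoly\<close> sort the words by the number of links
  between cyclic neighbours: none in the sum over \<open>S4\<close>, one in the sum over
  \<open>C4\<close> and its coset, two or three in the last one. The rotations in \<open>C4\<close>
  carry the links around the cycle.\<close>

lemma ev_wpoly:
  fixes x :: "nat \<Rightarrow> real"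
  shows "ev (\<lambda>i. of_real (x i)) (wpoly l1 l2 l3 l4) =
    altsum (\<lambda>p q r s. of_real (p ^ (l1 - 1) * q ^ (l2 - 1) * r ^ (l3 - 1) * s ^ (l4 - 1))) (x 1) (x 2) (x 3) (x 4)"
proof -
  define \<Phi> :: "real \<Rightarrow> real \<Rightarrow> real \<Rightarrow> real \<Rightarrow> complex" where
    "\<Phi> = (\<lambda>p q r s. of_real (p ^ (l1 - 1) * q ^ (l2 - 1) * r ^ (l3 - 1) * s ^ (l4 - 1)))"
  define S where "S = (\<lambda>ws. \<Sum>(p, q, r, s)\<leftarrow>ws. \<Phi> p q r s)"
  define E where "E = ev (\<lambda>i. of_real (x i))"
  define M where "M = xpow4 l1 l2 l3 l4"
  have sum: "(\<Sum>j\<leftarrow>js. of_real (x (\<sigma> j)) :: complex) = of_real (\<Sum>j\<leftarrow>js. x (\<sigma> j))" for js \<sigma>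
    by (induction js) auto
  have \<Phi>: "E (\<sigma> \<bullet>\<^sub>S M A B C D) =
    \<Phi> (\<Sum>j\<leftarrow>A. x (\<sigma> j)) (\<Sum>j\<leftarrow>B. x (\<sigma> j)) (\<Sum>j\<leftarrow>C. x (\<sigma> j)) (\<Sum>j\<leftarrow>D. x (\<sigma> j))" for \<sigma> A B C D
    unfolding E_def M_def act_xpow4 by (simp add: xpow4_def ev_mult ev_xpow sum \<Phi>_def comp_def)
  have lin: "E (f + g) = E f + E g" "E (f - g) = E f - E g" for f g
    by (simp_all add: E_def ev_add ev_diff)
  have E_sum: "E (sum f A) = (\<Sum>\<sigma>\<in>A. E (f \<sigma>))" for f and A :: "(nat \<Rightarrow> nat) set"
    by (simp add: E_def ev_sum)
  define f1 where "f1 = M [1,2,3,4] [2,3,4] [3,4] [4]"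
  define f2 where "f2 = (\<Sum>\<rho>\<in>gen4 (cycle_of_list [2, 3, 4]). M [1,3,4] [\<rho> 2, \<rho> 3, \<rho> 4] [\<rho> 3, \<rho> 4] [\<rho> 4])
         + (\<Sum>\<rho>\<in>gen4 (cycle_of_list [2, 4]). M [3,1,4] [1,4] [\<rho> 2, \<rho> 4] [\<rho> 4])
         + M [3,4,1] [4,1] [1] [2]"
  define f3 where "f3 = (\<Sum>\<nu>\<in>B4. \<Sum>\<rho>\<in>gen4 (cycle_of_list [\<nu> 2, 4]).
            M [1, \<nu> 3] [\<nu> 3, 2] [\<rho> (\<nu> 2), \<rho> 4] [\<rho> 4])
         + (\<Sum>\<nu>\<in>B4. M [\<nu> 1, 3] [2, \<nu> 3] [\<nu> 3] [\<nu> 4])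
         + M [4,1] [1] [2] [3] - M [1] [2] [3] [4]"
  have 1: "E (\<Sum>\<sigma>\<in>S4. \<sigma> \<bullet>\<^sub>S f1) = S (words1111 (x 1) (x 2) (x 3) (x 4))"
  proof -
    obtain a b c d where abcd: "x 1 = a" "x (Suc 0) = a" "x 2 = b" "x 3 = c" "x 4 = d" by simp
    show ?thesis
      unfolding E_sum unfolding f1_def \<Phi> unfolding sum_S4 S_def words1111_def
      by (simp add: Transposition.transpose_def abcd) (simp only: add_ac)
  qed
  \<comment> \<open>The product of one chain of length 2 with two single letters is symmetric in the
    latter, which (34) exchanges. So \<open>f2\<close> lists six of the twelve words and the coset
    supplies the other six.\<close>
  have 2: "E (\<sigma> \<bullet>\<^sub>S f2) + E ((\<sigma> \<circ> cycle_of_list [3, 4]) \<bullet>\<^sub>S f2) = S (words211 (x (\<sigma> 1)) (x (\<sigma> 2)) (x (\<sigma> 3)) (x (\<sigma> 4)))" for \<sigma>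
    unfolding f2_def sum_gen4_234 sum_gen4_24 lin act_add act_diff \<Phi> S_def words211_def
    by (simp add: cycle_values add_ac del: cycle_of_list.simps)
  \<comment> \<open>This matches \<open>words31\<close> and \<open>words22\<close> only after
    summation over \<open>C4\<close>. The words of \<open>words22\<close> are permuted by the
    rotation by two, so one half of them suffices here; likewise the term starting with b + c is a
    word of \<open>words31\<close> rotated by two.\<close>
  have f3: "E (\<sigma> \<bullet>\<^sub>S f3) = (let a = x (\<sigma> 1); b = x (\<sigma> 2); c = x (\<sigma> 3); d = x (\<sigma> 4) in
      \<Phi> (a + c) (b + c) (b + d) d + \<Phi> (a + c) (b + c) (b + d) b + \<Phi> (a + c) (b + c) c d
      + \<Phi> (a + d) (b + d) (c + d) d + \<Phi> (a + d) (b + d) (c + d) c + \<Phi> (b + c) (b + d) d a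
      + \<Phi> (a + d) a b c - \<Phi> a b c d)" for \<sigma>
    unfolding f3_def sum_B4 id_apply cycle_values lin act_add act_diff \<Phi>
    by (simp add: cycle_values sum_gen4_24 sum_gen4_34 lin act_add act_diff \<Phi> add_ac Let_def del: cycle_of_list.simps)
  have 3: "E (\<Sum>\<sigma>\<in>C4. \<sigma> \<bullet>\<^sub>S f3) = S (words31 (x 1) (x 2) (x 3) (x 4)) + S (words31 (x 2) (x 3) (x 4) (x 1))
      + S (words31 (x 3) (x 4) (x 1) (x 2)) + S (words31 (x 4) (x 1) (x 2) (x 3))
      + S (words22 (x 1) (x 2) (x 3) (x 4)) + S (words22 (x 2) (x 3) (x 4) (x 1))
      - (\<Phi> (x 1) (x 2) (x 3) (x 4) + \<Phi> (x 2) (x 3) (x 4) (x 1) + \<Phi> (x 3) (x 4) (x 1) (x 2) + \<Phi> (x 4) (x 1) (x 2) (x 3))"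
    unfolding E_sum unfolding sum_C4 f3 Let_def S_def words31_def words22_def
    by (simp add: cycle_values add_ac)
  have 2: "E (\<Sum>\<sigma>\<in>C4 \<union> (C4 #>\<^bsub>sym_group 4\<^esub> cycle_of_list [3, 4]). \<sigma> \<bullet>\<^sub>S f2) =
      S (words211 (x 1) (x 2) (x 3) (x 4)) + S (words211 (x 2) (x 3) (x 4) (x 1))
      + S (words211 (x 3) (x 4) (x 1) (x 2)) + S (words211 (x 4) (x 1) (x 2) (x 3))"
    unfolding E_sum unfolding sum_C4_coset sum.distrib[symmetric] 2
    unfolding sum_C4 by (simp add: cycle_values)
  have wpoly: "wpoly l1 l2 l3 l4 = (\<Sum>\<sigma>\<in>S4. \<sigma> \<bullet>\<^sub>S f1)
      - (\<Sum>\<sigma>\<in>C4 \<union> (C4 #>\<^bsub>sym_group 4\<^esub> cycle_of_list [3, 4]). \<sigma> \<bullet>\<^sub>S f2) + (\<Sum>\<sigma>\<in>C4. \<sigma> \<bullet>\<^sub>S f3)"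
    unfolding wpoly_def f1_def f2_def f3_def M_def xpow4_def ..
  have "E (wpoly l1 l2 l3 l4) = altsum \<Phi> (x 1) (x 2) (x 3) (x 4)"
    unfolding wpoly lin 1 2 3 altsum_words S_def by (simp only: algebra_simps)
  then show ?thesis unfolding E_def \<Phi>_def .
qed

lemma altsum_of_real:
  "altsum (\<lambda>p q r s. of_real (F p q r s)) a b c d = (of_real (altsum F a b c d) :: complex)"
proof -
  have "(\<Sum>(e, p, q, r, s)\<leftarrow>ws. of_int e * of_real (F p q r s)) =
    (of_real (\<Sum>(e, p, q, r, s)\<leftarrow>ws. of_int e * F p q r s) :: complex)" for ws
    by (induction ws) auto
  then show ?thesis unfolding altsum_def .
qed

lemma altsum_sum:
  "(\<Sum>k\<in>A. altsum (F k) a b c d * w k) = altsum (\<lambda>p q r s. \<Sum>k\<in>A. F k p q r s * w k) a b c (d :: real)"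
proof -
  have "(\<Sum>k\<in>A. (\<Sum>(e, p, q, r, s)\<leftarrow>ws. of_int e * F k p q r s) * w k) =
    (\<Sum>(e, p, q, r, s)\<leftarrow>ws. of_int e * (\<Sum>k\<in>A. F k p q r s * w k))" for ws
    by (induction ws) (auto simp: distrib_right sum.distrib sum_distrib_left mult.assoc)
  then show ?thesis unfolding altsum_def .
qed

theorem theorem1p1:
  fixes l :: nat
  assumes "l \<ge> 5"
  shows "(\<Sum>(l1, l2, l3, l4) \<in> {(l1, l2, l3, l4). l1 \<ge> 2 \<and> l2 \<ge> 1 \<and> l3 \<ge> 1 \<and> l4 \<ge> 1
              \<and> l1 + l2 + l3 + l4 = l}.
            wpoly l1 l2 l3 l4 * scalar (of_real (mzv [l1, l2, l3, l4])))
       = (\<Sum>(l1, l2, l3, l4) \<in> {(l1, l2, l3, l4). l1 \<ge> 1 \<and> l2 \<ge> 1 \<and> l3 \<ge> 1 \<and> l4 \<ge> 1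
              \<and> l1 + l2 + l3 + l4 = l}.
            indet 1 ^ (l1 - 1) * indet 2 ^ (l2 - 1) * indet 3 ^ (l3 - 1) * indet 4 ^ (l4 - 1))
         * scalar (of_real (zeta_nat l))"
    (is "?lhs = ?rhs")
proof -
  \<comment> \<open>The degree in the indeterminates is n, so \<open>l \<ge> 5\<close> means
    positive degree, where the constant zeta(4) is not seen.\<close>
  define n where "n = l - 4"
  have n: "n \<ge> 1" "l = n + 4" using assms by (auto simp: n_def)
  let ?shift = "\<lambda>(k1, k2, k3, k4). (Suc k1, Suc k2, Suc k3, Suc k4)"
  have inj: "inj_on ?shift K" for K by (auto simp: inj_on_def)
  have mem: "(l1, l2, l3, l4) \<in> ?shift ` K \<longleftrightarrow>
      l1 \<ge> 1 \<and> l2 \<ge> 1 \<and> l3 \<ge> 1 \<and> l4 \<ge> 1 \<and> (l1 - 1, l2 - 1, l3 - 1, l4 - 1) \<in> K" for l1 l2 l3 l4 K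
    by (cases l1; cases l2; cases l3; cases l4) force+
  have L: "{(l1, l2, l3, l4). l1 \<ge> 2 \<and> l2 \<ge> 1 \<and> l3 \<ge> 1 \<and> l4 \<ge> 1 \<and> l1 + l2 + l3 + l4 = l} = ?shift ` chain_family.slice n"
    unfolding set_eq_iff split_paired_All mem chain_family.slice_def using n by auto
  have R: "{(l1, l2, l3, l4). l1 \<ge> 1 \<and> l2 \<ge> 1 \<and> l3 \<ge> 1 \<and> l4 \<ge> 1 \<and> l1 + l2 + l3 + l4 = l} = ?shift ` diag_family.slice n"
    unfolding set_eq_iff split_paired_All mem diag_family.slice_def using n by auto
  \<comment> \<open>It suffices to compare values at real points between 0 and 1/8, a range in which
    \<open>altsum_mzv\<close> applies.\<close>
  have "?lhs - ?rhs = 0"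
  proof (rule cpoly_eq_0)
    fix x :: "nat \<Rightarrow> real"
    assume x: "\<And>i. 0 < x i \<and> x i < 1/8"
    then have b: "\<bar>x i\<bar> \<le> 1/8" for i by (simp add: less_imp_le)
    have "ev (\<lambda>i. of_real (x i)) ?lhs = of_real (\<Sum>(k1, k2, k3, k4)\<in>chain_family.slice n.
        altsum (\<lambda>p q r s. p ^ k1 * q ^ k2 * r ^ k3 * s ^ k4) (x 1) (x 2) (x 3) (x 4) * mzv [Suc k1, Suc k2, Suc k3, Suc k4])"
      unfolding L sum.reindex[OF inj]
      by (simp add: ev_sum case_prod_unfold ev_mult ev_wpoly altsum_of_real del: of_real_mult of_real_power)
        (simp only: of_real_sum of_real_mult)
    also have "(\<Sum>(k1, k2, k3, k4)\<in>chain_family.slice n.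
        altsum (\<lambda>p q r s. p ^ k1 * q ^ k2 * r ^ k3 * s ^ k4) (x 1) (x 2) (x 3) (x 4) * mzv [Suc k1, Suc k2, Suc k3, Suc k4])
      = altsum (\<lambda>p q r s. \<Sum>(k1, k2, k3, k4)\<in>chain_family.slice n.
      p ^ k1 * q ^ k2 * r ^ k3 * s ^ k4 * mzv [Suc k1, Suc k2, Suc k3, Suc k4]) (x 1) (x 2) (x 3) (x 4)"
      unfolding case_prod_unfold by (rule altsum_sum)
    also have "\<dots> = (\<Sum>(k1, k2, k3, k4)\<in>diag_family.slice n. x 1 ^ k1 * x 2 ^ k2 * x 3 ^ k3 * x 4 ^ k4) * zeta_nat (n + 4)"
      by (rule altsum_mzv[OF b b b b n(1)])
    also have "of_real \<dots> = ev (\<lambda>i. of_real (x i)) ?rhs"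
      unfolding R sum.reindex[OF inj] unfolding n(2)
      by (simp add: ev_sum case_prod_unfold ev_mult ev_power)
    finally show "ev (\<lambda>i. of_real (x i)) (?lhs - ?rhs) = 0"
      by (simp add: ev_diff)
  qed
  then show ?thesis by simp
qed

end
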